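(* The problem Generalized Noise Role Mining, with input an $m\times n$ Boolean matrix $\mathbf{UPA}$, an $m\times n$ label matrix $\mathbf{F}$ with entries in $\{\top,\bot\}$, and integers $k\ge 0$ and $r\ge 1$, admits an algorithm running in time $\mathcal{O}^*(2^{\mathcal{O}(r2^r+rk)})$.
   Context: A Boolean matrix is a matrix with entries in $\{0,1\}$. For Boolean matrices $\mathbf{A}$ ($m\times r$) and $\mathbf{B}$ ($r\times n$), the Boolean product $\mathbf{C}=\mathbf{A}\wedge\mathbf{B}$ is the $m\times n$ Boolean matrix with $c_{ij}=\bigvee_{\ell=1}^{r}(a_{i\ell}\wedge b_{\ell j})$. A label matrix is a matrix $\mathbf{F}$ with entries $f_{ij}\in\{\top,\bot\}$. For $m\times n$ Boolean matrices $\mathbf{A},\mathbf{B}$ and an $m\times n$ label matrix $\mathbf{F}$, define $\mathsf{sd}_{\mathbf{F}}(a_{ij},b_{ij})=\infty$ if $f_{ij}=\bot$ and $a_{ij}\neq b_{ij}$, and $\mathsf{sd}_{\mathbf{F}}(a_{ij},b_{ij})=|a_{ij}-b_{ij}|$ otherwise; and $\mathsf{sd}_{\mathbf{F}}(\mathbf{A},\mathbf{B})=\sum_{i=1}^m\sum_{j=1}^n \mathsf{sd}_{\mathbf{F}}(a_{ij},b_{ij})$. Generalized Noise Role Mining (GNRM): given an $m\times n$ Boolean matrix $\mathbf{UPA}$, an $m\times n$ label matrix $\mathbf{F}$, and integers $k\ge0$, $r\ge1$ (the parameter being $k+r$), decide whether there exist an $m\times r$ Boolean matrix $\mathbf{UA}$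 and an $r\times n$ Boolean matrix $\mathbf{PA}$ such that $\mathsf{sd}_{\mathbf{F}}(\mathbf{UPA},\mathbf{UA}\wedge\mathbf{PA})\le k$; if the answer is yes, return such matrices $\mathbf{UA}$ and $\mathbf{PA}$. The notation $\mathcal{O}^*(g)$ means $\mathcal{O}(g\cdot |I|^c)$, where $|I|$ is the size of the input and $c$ is an absolute constant. *)

theory Defs
  imports
    "Jordan_Normal_Form.Matrix"
    "HOL-Library.Extended_Nat"
    "HOL-Library.Log_Nat"
    "HOL-Library.Landau_Symbols"
begin

section \<open>Generalized Noise Role Mining\<close>

definition bool_mult_mat :: "bool mat \<Rightarrow> bool mat \<Rightarrow> bool mat" (infixl "\<and>\<^sub>m" 70) where
  "A \<and>\<^sub>m B = mat (dim_row A) (dim_col B)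
     (\<lambda>(i, j). \<exists>l < dim_col A. A $$ (i, l) \<and> B $$ (l, j))"

datatype label = Lab_Top | Lab_Bot

definition sd_entry :: "label \<Rightarrow> bool \<Rightarrow> bool \<Rightarrow> enat" where
  "sd_entry f a b =
     (if f = Lab_Bot \<and> a \<noteq> b then \<infinity> else enat (nat \<bar>of_bool a - of_bool b :: int\<bar>))"

definition sd :: "label mat \<Rightarrow> bool mat \<Rightarrow> bool mat \<Rightarrow> enat" where
  "sd F A B = (\<Sum>i<dim_row A. \<Sum>j<dim_col A. sd_entry (F $$ (i, j)) (A $$ (i, j)) (B $$ (i, j)))"

text \<open>The dimensions \<open>m\<close> and \<open>n\<close> of an instance are those of the matrix \<open>upa\<close>.\<close>

record gnrm =
  upa :: "bool mat"
  labels :: "label mat"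
  noise :: nat
  roles :: nat

definition gnrm_instances :: "gnrm set" where
  "gnrm_instances =
     {I. labels I \<in> carrier_mat (dim_row (upa I)) (dim_col (upa I)) \<and> roles I \<ge> 1}"

definition gnrm_solution :: "gnrm \<Rightarrow> bool mat \<Rightarrow> bool mat \<Rightarrow> bool" where
  "gnrm_solution I UA PA \<longleftrightarrow>
     UA \<in> carrier_mat (dim_row (upa I)) (roles I) \<and>
     PA \<in> carrier_mat (roles I) (dim_col (upa I)) \<and>
     sd (labels I) (upa I) (UA \<and>\<^sub>m PA) \<le> enat (noise I)"

section \<open>Random access machines\<close>

text \<open>
  Algorithms are programs of a random access machine with a read-only, randomly accessible
  input, an unbounded memory of natural numbers that is initially zero, and a write-only output.
  Control flow is structured. \<open>Sub\<close> is truncated subtraction. Time is unit cost: every evaluated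
  expression node and every executed instruction or test counts 1. As there is no
  multiplication or shift, a number computed within \<open>t\<close> steps exceeds the largest constant of
  the program and the largest input word by a factor of at most \<open>2 ^ t\<close>, so the model is
  polynomially equivalent to Turing machines.
\<close>

datatype exp = Const nat | Input exp | Mem exp | Add exp exp | Sub exp exp

datatype com =
    Skip
  | Store exp exp  \<comment> \<open>address and value\<close>
  | Write exp
  | Seq com com
  | If exp com com
  | While exp com

type_synonym state = "(nat \<Rightarrow> nat) \<times> nat list"

fun eval :: "(nat \<Rightarrow> nat) \<Rightarrow> (nat \<Rightarrow> nat) \<Rightarrow> exp \<Rightarrow> nat" where
  "eval inp M (Const n) = n"
| "eval inp M (Input e) = inp (eval inp M e)"
| "eval inp M (Mem e) = M (eval inp M e)"
| "eval inp M (Add e1 e2) = eval inp M e1 + eval inp M e2"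
| "eval inp M (Sub e1 e2) = eval inp M e1 - eval inp M e2"

fun cost :: "exp \<Rightarrow> nat" where
  "cost (Const n) = 1"
| "cost (Input e) = 1 + cost e"
| "cost (Mem e) = 1 + cost e"
| "cost (Add e1 e2) = 1 + cost e1 + cost e2"
| "cost (Sub e1 e2) = 1 + cost e1 + cost e2"

text \<open>
  \<open>exec inp c s t s'\<close>: on input \<open>inp\<close>, the program \<open>c\<close> started in state \<open>s\<close>
  terminates in state \<open>s'\<close> after exactly \<open>t\<close> time steps.
\<close>

inductive exec :: "(nat \<Rightarrow> nat) \<Rightarrow> com \<Rightarrow> state \<Rightarrow> nat \<Rightarrow> state \<Rightarrow> bool" for inp where
  Skip: "exec inp Skip s 1 s"
| Store: "exec inp (Store a e) (M, out) (1 + cost a + cost e)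
            (M(eval inp M a := eval inp M e), out)"
| Write: "exec inp (Write e) (M, out) (1 + cost e) (M, out @ [eval inp M e])"
| Seq: "exec inp c1 s t1 s' \<Longrightarrow> exec inp c2 s' t2 s'' \<Longrightarrow>
          exec inp (Seq c1 c2) s (t1 + t2) s''"
| IfTrue: "eval inp (fst s) e \<noteq> 0 \<Longrightarrow> exec inp c1 s t s' \<Longrightarrow>
          exec inp (If e c1 c2) s (1 + cost e + t) s'"
| IfFalse: "eval inp (fst s) e = 0 \<Longrightarrow> exec inp c2 s t s' \<Longrightarrow>
          exec inp (If e c1 c2) s (1 + cost e + t) s'"
| WhileFalse: "eval inp (fst s) e = 0 \<Longrightarrow> exec inp (While e c) s (1 + cost e) s"
| WhileTrue: "eval inp (fst s) e \<noteq> 0 \<Longrightarrow> exec inp c s t1 s' \<Longrightarrow>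
          exec inp (While e c) s' t2 s'' \<Longrightarrow>
          exec inp (While e c) s (1 + cost e + t1 + t2) s''"

inductive_cases SkipE: "exec inp Skip s t s'"
inductive_cases StoreE: "exec inp (Store a e) s t s'"
inductive_cases WriteE: "exec inp (Write e) s t s'"
inductive_cases SeqE: "exec inp (Seq c1 c2) s t s'"
inductive_cases IfE: "exec inp (If e c1 c2) s t s'"
inductive_cases WhileE: "exec inp (While e c) s t s'"

text \<open>Execution is deterministic, so output and running time are determined by the program
  and its input.\<close>

lemma exec_deterministic:
  "exec inp c s t s' \<Longrightarrow> exec inp c s u s'' \<Longrightarrow> u = t \<and> s'' = s'"
proof (induction arbitrary: u s'' rule: exec.induct)
  case (Skip s)
  then show ?case by (rule SkipE) simp
next
  case (Store a e M out)
  then show ?case by (rule StoreE) simp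
next
  case (Write e M out)
  then show ?case by (rule WriteE) simp
next
  case (Seq c1 s t1 s1 c2 t2 s2)
  from Seq.prems obtain u1 u2 v where
    "u = u1 + u2" "exec inp c1 s u1 v" "exec inp c2 v u2 s''"
    by (rule SeqE) blast
  then show ?case using Seq.IH by metis
next
  case (IfTrue s e c1 t s1 c2)
  from IfTrue.prems IfTrue.hyps(1) obtain u1 where
    "u = 1 + cost e + u1" "exec inp c1 s u1 s''"
    by (elim IfE) simp_all
  then show ?case using IfTrue.IH by metis
next
  case (IfFalse s e c2 t s1 c1)
  from IfFalse.prems IfFalse.hyps(1) obtain u1 where
    "u = 1 + cost e + u1" "exec inp c2 s u1 s''"
    by (elim IfE) simp_all
  then show ?case using IfFalse.IH by metis
next
  case (WhileFalse s e c)
  from WhileFalse.prems show ?case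
    by (rule WhileE) (simp_all add: WhileFalse.hyps)
next
  case (WhileTrue s e c t1 s1 t2 s2)
  obtain u1 u2 v where
    u: "u = Suc (cost e + u1 + u2)" and c: "exec inp c s u1 v"
      and w: "exec inp (While e c) v u2 s''"
    by (rule WhileE[OF WhileTrue.prems]) (use WhileTrue.hyps(1) in blast)+
  from WhileTrue.IH(1)[OF c] have "u1 = t1" "v = s1" by simp_all
  with WhileTrue.IH(2) w have "u2 = t2" "s'' = s2" by metis+
  with u \<open>u1 = t1\<close> show ?case by simp
qed

definition computes :: "com \<Rightarrow> nat list \<Rightarrow> nat \<Rightarrow> nat list \<Rightarrow> bool" where
  "computes p xs t ys \<longleftrightarrow>
     (\<exists>M. exec (\<lambda>i. if i < length xs then xs ! i else 0) p (\<lambda>_. 0, []) t (M, ys))"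

section \<open>Encoding and running time\<close>

definition mat_words :: "('a \<Rightarrow> nat) \<Rightarrow> 'a mat \<Rightarrow> nat list" where
  "mat_words w A = concat (map (\<lambda>i. map (\<lambda>j. w (A $$ (i, j))) [0..<dim_col A]) [0..<dim_row A])"

abbreviation bool_words :: "bool mat \<Rightarrow> nat list" where
  "bool_words \<equiv> mat_words of_bool"

abbreviation label_words :: "label mat \<Rightarrow> nat list" where
  "label_words \<equiv> mat_words (\<lambda>f. of_bool (f = Lab_Top))"

definition gnrm_input :: "gnrm \<Rightarrow> nat list" where
  "gnrm_input I = [dim_row (upa I), dim_col (upa I), noise I, roles I] @
     bool_words (upa I) @ label_words (labels I)"

text \<open>
  The output is \<open>0\<close> for "no", and \<open>1\<close> followed by the entries of a solution for "yes".
\<close>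

definition gnrm_output :: "gnrm \<Rightarrow> nat list \<Rightarrow> bool" where
  "gnrm_output I ys \<longleftrightarrow>
     (if \<exists>UA PA. gnrm_solution I UA PA
      then \<exists>UA PA. gnrm_solution I UA PA \<and> ys = 1 # bool_words UA @ bool_words PA
      else ys = [0])"

text \<open>
  Input size: \<open>k\<close> and \<open>r\<close> count with their binary length. The summand \<open>m + n\<close> matters only for
  matrices without rows or without columns; otherwise it is at most \<open>2 * m * n\<close>.
\<close>

definition gnrm_size :: "gnrm \<Rightarrow> nat" where
  "gnrm_size I =
     (let m = dim_row (upa I); n = dim_col (upa I)
      in 2 * m * n + m + n + floorlog 2 (noise I) + floorlog 2 (roles I))"

definition gnrm_solved_by :: "com \<Rightarrow> (gnrm \<Rightarrow> nat) \<Rightarrow> bool" where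
  "gnrm_solved_by p T \<longleftrightarrow>
     (\<forall>I \<in> gnrm_instances. \<exists>ys. computes p (gnrm_input I) (T I) ys \<and> gnrm_output I ys)"

text \<open>
  With the principal filter, \<open>O\<close> asks for one constant that works for every instance.
\<close>

abbreviation gnrm_O :: "(gnrm \<Rightarrow> real) \<Rightarrow> (gnrm \<Rightarrow> real) set" where
  "gnrm_O g \<equiv> O[principal gnrm_instances](g)"

definition gnrm_O_star :: "(gnrm \<Rightarrow> real) \<Rightarrow> (gnrm \<Rightarrow> real) set" where
  "gnrm_O_star g = (\<Union>c::nat. gnrm_O (\<lambda>I. g I * real (gnrm_size I) ^ c))"

end

(*
  If some row of UPA occurs unmodified as a row of UA * PA, every equal row of UPA can be given the
  same roles at no cost, and likewise for columns. Hence a solution is determined by the role sets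
  of at most 2^r + k rows (the unmodified ones realise at most 2^r distinct role sets, at most k
  rows are modified) and of equally many columns. Each of these role sets is written down with one
  further bit telling whether the row or column is unmodified, so that the decoder knows when
  to copy instead of reading on. This describes some solution by 4 r (2^r + k) bits, and the
  program tries all bit strings of this length with a binary counter.
*)
theory Submission
  imports Defs
begin

section \<open>Weakest preconditions with running time\<close>

text \<open>Correctness and running time are proved together: the postcondition of \<open>wp\<close>
  receives the time. Every natural number is a legal guess, since the decoder is total and each
  decoded pair is checked. Hence only completeness needs an argument: some number below
  \<open>2 ^ bit_count I\<close> must pass whenever the instance is solvable. The delicate point is
  that rows and columns are replaced at the same time: the entry at (i, j) becomes the entry of the
  old product at the sources (i0, j0). If a row or column was replaced, its source is exact and the
  new entry agrees with UPA; otherwise the entry is unchanged. So no entry gets more expensive,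
  although exactness always refers to the old product. A second obstacle: the input size counts r
  only by its binary length, so factors polynomial in r have to be absorbed into the exponential
  part of the running time.\<close>

definition wp :: "(nat \<Rightarrow> nat) \<Rightarrow> com \<Rightarrow> (nat \<Rightarrow> (nat \<Rightarrow> nat) \<Rightarrow> nat list \<Rightarrow> bool) \<Rightarrow>
    (nat \<Rightarrow> nat) \<Rightarrow> nat list \<Rightarrow> bool" where
  "wp inp c Q M out \<longleftrightarrow> (\<exists>t M' out'. exec inp c (M, out) t (M', out') \<and> Q t M' out')"

lemma wp_mono:
  assumes "wp inp c Q M out" "\<And>t M' out'. Q t M' out' \<Longrightarrow> Q' t M' out'"
  shows "wp inp c Q' M out"
  using assms unfolding wp_def by blast

lemma wp_Skip [simp]: "wp inp Skip Q M out = Q 1 M out"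
  unfolding wp_def by (metis SkipE exec.Skip prod.inject)

lemma wp_Store [simp]:
  "wp inp (Store a e) Q M out =
     Q (1 + cost a + cost e) (M(eval inp M a := eval inp M e)) out"
  unfolding wp_def by (auto elim!: StoreE intro!: exec.Store exI)

lemma wp_Write [simp]:
  "wp inp (Write e) Q M out = Q (1 + cost e) M (out @ [eval inp M e])"
  unfolding wp_def by (auto elim!: WriteE intro!: exec.Write exI)

lemma wp_Seq [simp]:
  "wp inp (Seq c1 c2) Q M out =
     wp inp c1 (\<lambda>t1. wp inp c2 (\<lambda>t2. Q (t1 + t2))) M out"
  unfolding wp_def by (auto elim!: SeqE) (metis exec.Seq)+

lemma wp_If [simp]:
  "wp inp (If e c1 c2) Q M out =
     (if eval inp M e \<noteq> 0 then wp inp c1 (\<lambda>t. Q (1 + cost e + t)) M out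
      else wp inp c2 (\<lambda>t. Q (1 + cost e + t)) M out)"
proof (cases "eval inp M e = 0")
  case True
  then have "exec inp (If e c1 c2) (M, out) t s \<longleftrightarrow>
      (\<exists>u. t = 1 + cost e + u \<and> exec inp c2 (M, out) u s)" for t s
    using exec.IfFalse[of inp "(M, out)" e c2 _ _ c1] by (cases s) (auto elim!: IfE)
  with True show ?thesis unfolding wp_def by auto
next
  case False
  then have "exec inp (If e c1 c2) (M, out) t s \<longleftrightarrow>
      (\<exists>u. t = 1 + cost e + u \<and> exec inp c1 (M, out) u s)" for t s
    using exec.IfTrue[of inp "(M, out)" e c1 _ _ c2] by (cases s) (auto elim!: IfE)
  with False show ?thesis unfolding wp_def by auto
qed

text \<open>The invariant carries the number of rounds, and a true guard must imply
  \<open>i < n\<close>; thus \<open>n - i\<close> is the termination measure and n bounds the rounds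
  even if the loop stops early. The trailing \<open>cost e + 1\<close> pays for the last, failing
  guard.\<close>

lemma wp_While:
  assumes "J i M out"
    and step: "\<And>i M out. J i M out \<Longrightarrow> eval inp M e \<noteq> 0 \<Longrightarrow>
      i < n \<and> wp inp c (\<lambda>t M' out'. t \<le> b \<and> J (Suc i) M' out') M out"
    and post: "\<And>i M out t. J i M out \<Longrightarrow> eval inp M e = 0 \<Longrightarrow>
      t \<le> n * (b + cost e + 1) + cost e + 1 \<Longrightarrow> Q t M out"
  shows "wp inp (While e c) Q M out"
proof -
  have "\<exists>t M' out' i'. exec inp (While e c) (M, out) t (M', out') \<and> J i' M' out' \<and>
      eval inp M' e = 0 \<and> t \<le> (n - i) * (b + cost e + 1) + cost e + 1"
    using assms(1)
  proof (induction "n - i" arbitrary: i M out)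
    case 0
    then have "eval inp M e = 0" using step[of i M out] by fastforce
    moreover from this have "exec inp (While e c) (M, out) (1 + cost e) (M, out)"
      by (intro exec.WhileFalse) simp
    ultimately show ?case using 0 by force
  next
    case (Suc d)
    show ?case
    proof (cases "eval inp M e = 0")
      case True
      moreover from this have "exec inp (While e c) (M, out) (1 + cost e) (M, out)"
        by (intro exec.WhileFalse) simp
      ultimately show ?thesis using Suc.prems by force
    next
      case False
      with step[OF Suc.prems] obtain t1 M1 out1 where
        1: "i < n" "exec inp c (M, out) t1 (M1, out1)" "t1 \<le> b" "J (Suc i) M1 out1"
        unfolding wp_def by blast
      have "d = n - Suc i" using Suc.hyps(2) by simp
      from Suc.hyps(1)[OF this 1(4)] obtain t2 M2 out2 i2 where
        2: "exec inp (While e c) (M1, out1) t2 (M2, out2)" "J i2 M2 out2" "eval inp M2 e = 0"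
          "t2 \<le> (n - Suc i) * (b + cost e + 1) + cost e + 1" by blast
      have "exec inp (While e c) (M, out) (1 + cost e + t1 + t2) (M2, out2)"
        using exec.WhileTrue[OF _ 1(2) 2(1)] False by simp
      moreover have "n - i = Suc (n - Suc i)" using 1(1) by simp
      then have "1 + cost e + t1 + t2 \<le> (n - i) * (b + cost e + 1) + cost e + 1"
        using 1(3) 2(4) by (simp only: mult_Suc)
      ultimately show ?thesis using 2(2,3) by blast
    qed
  qed
  then obtain t M' out' i' where *: "exec inp (While e c) (M, out) t (M', out')"
    "J i' M' out'" "eval inp M' e = 0" "t \<le> (n - i) * (b + cost e + 1) + cost e + 1" by blast
  have "(n - i) * (b + cost e + 1) \<le> n * (b + cost e + 1)" by (intro mult_right_mono) auto
  then have "t \<le> n * (b + cost e + 1) + cost e + 1" using *(4) by linarith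
  with * post show ?thesis unfolding wp_def by blast
qed

abbreviation (input) reg :: "nat \<Rightarrow> exp" where
  "reg x \<equiv> Mem (Const x)"

text \<open>Truncated subtraction makes the guard nonzero exactly while the counter is below the
  value of \<open>e\<close>. The bound \<open>e\<close> is evaluated anew for every test.\<close>

definition For :: "nat \<Rightarrow> exp \<Rightarrow> com \<Rightarrow> com" where
  "For x e c = Seq (Store (Const x) (Const 0))
     (While (Sub e (reg x)) (Seq c (Store (Const x) (Add (reg x) (Const 1)))))"

lemma wp_For:
  assumes init: "J 0 (M(x := 0)) out"
    and inv: "\<And>i M out. J i M out \<Longrightarrow> M x = i \<and> eval inp M e = n"
    and step: "\<And>i M out. J i M out \<Longrightarrow> i < n \<Longrightarrow>
      wp inp c (\<lambda>t M' out'. t \<le> b \<and> M' x = i \<and> J (Suc i) (M'(x := Suc i)) out') M out"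
    and post: "\<And>t M out. J n M out \<Longrightarrow> t \<le> n * (b + cost e + 10) + cost e + 8 \<Longrightarrow> Q t M out"
  shows "wp inp (For x e c) Q M out"
proof -
  have "wp inp (While (Sub e (reg x)) (Seq c (Store (Const x) (Add (reg x) (Const 1)))))
    (\<lambda>t. Q (3 + t)) (M(x := 0)) out"
  proof (rule wp_While[where J = "\<lambda>i M out. J i M out \<and> i \<le> n" and i = 0 and b = "b + 6" and n = n])
    show "J 0 (M(x := 0)) out \<and> 0 \<le> n" using init by simp
  next
    fix i M out assume *: "J i M out \<and> i \<le> n" "eval inp M (Sub e (reg x)) \<noteq> 0"
    then have "i < n" using inv[of i M out] by simp
    with step[of i M out] *
    show "i < n \<and> wp inp (Seq c (Store (Const x) (Add (reg x) (Const 1))))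
        (\<lambda>t M' out'. t \<le> b + 6 \<and> J (Suc i) M' out' \<and> Suc i \<le> n) M out"
      by (auto elim!: wp_mono)
  next
    fix i M out t assume *: "J i M out \<and> i \<le> n" "eval inp M (Sub e (reg x)) = 0"
      "t \<le> n * (b + 6 + cost (Sub e (reg x)) + 1) + cost (Sub e (reg x)) + 1"
    then have "i = n" using inv[of i M out] by simp
    \<comment> \<open>Each round pays 6 for the increment and \<open>cost e + 4\<close> for the
      guard; outside the rounds there are 3 for the initial assignment and \<open>cost e + 4\<close>
      for the last guard.\<close>
    moreover have "3 + t \<le> n * (b + cost e + 10) + cost e + 8"
      using *(3) by (simp add: add.assoc add.commute)
    ultimately show "Q (3 + t) M out" using *(1) post by blast
  qed
  then show ?thesis unfolding For_def by (simp add: numeral_3_eq_3)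
qed

section \<open>Decoding a bit string\<close>

text \<open>
  Memory layout: cells below 20 are registers, some of them used by several phases under different
  names. The decoded rows occupy the cells \<open>20 + i\<close>, the decoded columns the cells
  \<open>20 + m + j\<close>, each holding the offset of a role set in the bit string, which starts
  at cell \<open>20 + m + n\<close>.
\<close>

abbreviation (input) r_end :: nat where "r_end \<equiv> 0"
abbreviation (input) r_lab :: nat where "r_lab \<equiv> 1"
abbreviation (input) r_found :: nat where "r_found \<equiv> 2"
abbreviation (input) r_next :: nat where "r_next \<equiv> 3"
abbreviation (input) r_item :: nat where "r_item \<equiv> 4"
abbreviation (input) r_adr :: nat where "r_adr \<equiv> 5"
abbreviation (input) r_pick :: nat where "r_pick \<equiv> 6"
abbreviation (input) r_item' :: nat where "r_item' \<equiv> 7"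
abbreviation (input) r_adr' :: nat where "r_adr' \<equiv> 8"
abbreviation (input) r_cell :: nat where "r_cell \<equiv> 9"
abbreviation (input) r_ofs :: nat where "r_ofs \<equiv> 10"
abbreviation (input) r_diff :: nat where "r_diff \<equiv> 11"

abbreviation (input) in_m :: exp where "in_m \<equiv> Input (Const 0)"
abbreviation (input) in_n :: exp where "in_n \<equiv> Input (Const 1)"
abbreviation (input) in_k :: exp where "in_k \<equiv> Input (Const 2)"
abbreviation (input) in_r :: exp where "in_r \<equiv> Input (Const 3)"

abbreviation (input) Seq_infix :: "com \<Rightarrow> com \<Rightarrow> com" (infixr ";;" 60) where
  "c1 ;; c2 \<equiv> Seq c1 c2"

abbreviation (input) Set_reg :: "nat \<Rightarrow> exp \<Rightarrow> com" (infix "::=" 65) where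
  "x ::= e \<equiv> Store (Const x) e"

text \<open>The truncated differences in both directions add up to the absolute difference, so
  \<open>r_diff\<close> stays zero exactly as long as all words agree. The stride makes one program
  serve for rows (stride 1) and columns (stride n); \<open>r_ofs\<close> accumulates it, as there is
  no multiplication.\<close>

definition compare_items :: "exp \<Rightarrow> exp \<Rightarrow> com" where
  "compare_items len stride =
     r_ofs ::= Const 0 ;;
     r_diff ::= Const 0 ;;
     For r_cell len (
       r_diff ::= Add (reg r_diff)
         (Add (Sub (Input (Add (reg r_adr) (reg r_ofs))) (Input (Add (reg r_adr') (reg r_ofs))))
              (Sub (Input (Add (reg r_adr') (reg r_ofs))) (Input (Add (reg r_adr) (reg r_ofs))))) ;;
       r_ofs ::= Add (reg r_ofs) stride)"

lemma wp_compare_items: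
  assumes len: "\<And>M. eval inp M len = L" "cost len \<le> 3"
    and stride: "\<And>M. eval inp M stride = S" "cost stride \<le> 3"
    and post: "\<And>t M'. t \<le> 100 * Suc L \<Longrightarrow> \<forall>z. z < 9 \<or> 12 \<le> z \<longrightarrow> M' z = M z \<Longrightarrow>
      M' r_diff = 0 \<longleftrightarrow> (\<forall>x<L. inp (M r_adr + x * S) = inp (M r_adr' + x * S)) \<Longrightarrow> Q t M' out"
  shows "wp inp (compare_items len stride) Q M out"
  unfolding compare_items_def wp_Seq wp_Store
proof (rule wp_For[where n = L and b = 45 and J = "\<lambda>i M' out'. out' = out \<and>
    (\<forall>z. z < 9 \<or> 12 \<le> z \<longrightarrow> M' z = M z) \<and> M' r_cell = i \<and> M' r_ofs = i * S \<and>
    (M' r_diff = 0 \<longleftrightarrow> (\<forall>x<i. inp (M r_adr + x * S) = inp (M r_adr' + x * S)))"], goal_cases)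
  case 1
  then show ?case by simp
next
  case (2 i M1 out1)
  then show ?case using len by simp
next
  case (3 i M1 out1)
  then have "M1 r_adr = M r_adr" "M1 r_adr' = M r_adr'" by simp_all
  then show ?case using 3 stride by (auto simp: All_less_Suc)
next
  case (4 t M' out')
  have "L * (45 + cost len + 10) \<le> L * 58" using len by (intro mult_left_mono) auto
  with 4(2) len(2) have "t + 6 \<le> 100 * Suc L" unfolding mult_Suc_right by linarith
  then show ?case using 4(1) by (auto intro!: post)
qed

text \<open>
  The bit string \<open>w\<close> is a sequence of blocks of length \<open>r + 1\<close>: a role set and
  the bit telling that it fits its item exactly. An item equal to an earlier item with an exact
  block is assigned that block, any other item reads the next one. The second component of
  \<open>gen\<close> is the offset of the first unread bit.
\<close>

primrec pick :: "(nat \<Rightarrow> bool) \<Rightarrow> nat \<Rightarrow> (nat \<Rightarrow> bool) \<Rightarrow> (nat \<Rightarrow> nat) \<Rightarrow> nat \<Rightarrow> nat \<Rightarrow> nat" where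
  "pick w r e f p 0 = p"
| "pick w r e f p (Suc t) = (if e t \<and> w (f t + r) then f t else pick w r e f p t)"

primrec gen :: "(nat \<Rightarrow> bool) \<Rightarrow> nat \<Rightarrow> (nat \<Rightarrow> nat \<Rightarrow> bool) \<Rightarrow> nat \<Rightarrow> nat \<Rightarrow> (nat \<Rightarrow> nat) \<times> nat" where
  "gen w r sim p 0 = (\<lambda>_. 0, p)"
| "gen w r sim p (Suc t) =
     (let (f, p') = gen w r sim p t; q = pick w r (\<lambda>t'. sim t' t) f p' t
      in (f(t := q), if q < p' then p' else Suc (p' + r)))"

abbreviation bits_base :: exp where
  "bits_base \<equiv> Add (Const 20) (Add in_m in_n)"

text \<open>The inner loop overwrites \<open>r_pick\<close> at every usable earlier item, so the
  last one wins, as in \<open>pick\<close>. The difference of \<open>r_next\<close> and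
  \<open>r_pick\<close> is nonzero exactly when the picked offset lies below the first unread bit,
  that is, when a block was copied.\<close>

definition gen_com :: "exp \<Rightarrow> exp \<Rightarrow> exp \<Rightarrow> exp \<Rightarrow> exp \<Rightarrow> com" where
  "gen_com tab cnt step len stride =
     r_adr ::= Const 4 ;;
     For r_item cnt (
       r_pick ::= reg r_next ;;
       r_adr' ::= Const 4 ;;
       For r_item' (reg r_item) (
         compare_items len stride ;;
         If (reg r_diff) Skip
           (If (Mem (Add bits_base (Add (Mem (Add tab (reg r_item'))) in_r)))
              (r_pick ::= Mem (Add tab (reg r_item'))) Skip) ;;
         r_adr' ::= Add (reg r_adr') step) ;;
       Store (Add tab (reg r_item)) (reg r_pick) ;;
       If (Sub (reg r_next) (reg r_pick)) Skip
         (r_next ::= Add (reg r_next) (Add in_r (Const 1))) ;;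
       r_adr ::= Add (reg r_adr) step)"

text \<open>The 4 skips the words for m, n, k and r. Equality is stated on input words, which keeps
  the verification of the decoder independent of instances.\<close>

definition item_eq :: "(nat \<Rightarrow> nat) \<Rightarrow> nat \<Rightarrow> nat \<Rightarrow> nat \<Rightarrow> nat \<Rightarrow> nat \<Rightarrow> bool" where
  "item_eq inp step len stride t t' \<longleftrightarrow>
     (\<forall>x<len. inp (4 + t * step + x * stride) = inp (4 + t' * step + x * stride))"

text \<open>All pairs of items are compared word by word, which gives the cube of a common bound
  \<open>X\<close> on the number and length of items. \<open>T + N \<le> B\<close> ensures that
  filling the table leaves the bit string intact.\<close>

lemma wp_gen_com:
  fixes inp and w :: "nat \<Rightarrow> bool"
  defines "B \<equiv> 20 + (inp 0 + inp 1)"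
  assumes tab: "\<And>M. eval inp M tab = T" "cost tab \<le> 5"
    and cnt: "\<And>M. eval inp M cnt = N" "cost cnt \<le> 3"
    and step: "\<And>M. eval inp M step = S" "cost step \<le> 3"
    and len: "\<And>M. eval inp M len = L" "cost len \<le> 3"
    and stride: "\<And>M. eval inp M stride = D" "cost stride \<le> 3"
    and T: "20 \<le> T" "T + N \<le> B"
    and w: "\<And>z. M (B + z) = of_bool (w z)"
    and N: "N < X" and L: "L < X"
    and post: "\<And>t M'. t \<le> 2000 * X ^ 3 \<Longrightarrow>
      \<forall>z. z < 3 \<or> (12 \<le> z \<and> (z < T \<or> T + N \<le> z)) \<longrightarrow> M' z = M z \<Longrightarrow>
      \<forall>i<N. M' (T + i) = fst (gen w (inp 3) (item_eq inp S L D) (M r_next) N) i \<Longrightarrow>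
      M' r_next = snd (gen w (inp 3) (item_eq inp S L D) (M r_next) N) \<Longrightarrow>
      M' r_adr = 4 + N * S \<Longrightarrow> Q t M' out"
  shows "wp inp (gen_com tab cnt step len stride) Q M out"
proof -
  let ?g = "gen w (inp 3) (item_eq inp S L D) (M r_next)"
  have X: "X \<ge> 1" using N by simp
  define inner where "inner = For r_item' (reg r_item) (
         compare_items len stride ;;
         If (reg r_diff) Skip
           (If (Mem (Add bits_base (Add (Mem (Add tab (reg r_item'))) in_r)))
              (r_pick ::= Mem (Add tab (reg r_item'))) Skip) ;;
         r_adr' ::= Add (reg r_adr') step)"
  have inner: "wp inp inner Q M1 out" if
    *: "M1 r_item = i" "i < N" "M1 r_adr = 4 + i * S" "M1 r_adr' = 4" "M1 r_pick = p"
    "\<And>i'. i' < i \<Longrightarrow> M1 (T + i') = f i'" "\<And>z. M1 (B + z) = of_bool (w z)"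
    "\<And>t M'. t \<le> 400 * X^2 \<Longrightarrow> \<forall>z. z < 6 \<or> 12 \<le> z \<longrightarrow> M' z = M1 z \<Longrightarrow>
       M' r_pick = pick w (inp 3) (\<lambda>t'. item_eq inp S L D t' i) f p i \<Longrightarrow> Q t M' out"
    for Q M1 i f p
    unfolding inner_def
  proof (rule wp_For[where n = i and b = "100 * X + 60" and J = "\<lambda>j M' out'. out' = out \<and>
     (\<forall>z. z < 6 \<or> 12 \<le> z \<longrightarrow> M' z = M1 z) \<and> M' r_item' = j \<and> M' r_adr' = 4 + j * S \<and>
     M' r_pick = pick w (inp 3) (\<lambda>t'. item_eq inp S L D t' i) f p j"], goal_cases)
    case 1
    then show ?case using * by simp
  next
    case (2 j M2 out2)
    then show ?case using * by simp
  next
    case (3 j M2 out2)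
    have rd: "M3 (T + j) = f j" "M3 (B + (f j + inp 3)) = of_bool (w (f j + inp 3))"
      if "\<forall>z. z < 9 \<or> 12 \<le> z \<longrightarrow> M3 z = M2 z" for M3
    proof -
      have "M3 (T + j) = M1 (T + j)" using that 3(1) T by simp
      then show "M3 (T + j) = f j" using *(6)[OF 3(2)] by simp
      have "M3 (B + (f j + inp 3)) = M1 (B + (f j + inp 3))" using that 3(1) by (simp add: B_def)
      then show "M3 (B + (f j + inp 3)) = of_bool (w (f j + inp 3))" using *(7) by simp
    qed
    have X': "100 * Suc L \<le> 100 * X" using L by simp
    show ?case unfolding wp_Seq
    proof (rule wp_compare_items[OF len stride], goal_cases)
      case (1 t M3)
      note t = 1(1) and M3 = 1(2) and d = 1(3)
      have "t + 50 \<le> 100 * X + 60" using t X' by linarith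
      moreover have "M3 4 = i" "M3 5 = 4 + i * S" "M3 7 = j" "M3 8 = 4 + j * S"
        "M3 r_pick = pick w (inp 3) (\<lambda>t'. item_eq inp S L D t' i) f p j"
        using 3(1) M3 *(1,3) by simp_all
      moreover have "M3 r_diff = 0 \<longleftrightarrow> item_eq inp S L D j i"
        using d 3(1) *(3) by (auto simp: item_eq_def)
      moreover have "M3 z = M1 z" if "z < 6 \<or> 12 \<le> z" for z
      proof -
        have "z < 9 \<or> 12 \<le> z" using that by auto
        then show ?thesis using 3(1) M3 that by metis
      qed
      ultimately show ?case
        using rd[OF M3] tab step 3(1) unfolding B_def
        by (cases "item_eq inp S L D j i") simp_all
    qed
  next
    case (4 t M2 out2)
    \<comment> \<open>Since \<open>X \<ge> 1\<close>, additive constants are absorbed: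
      \<open>100 * X + 72 \<le> 172 * X\<close>.\<close>
    have "i * (100 * X + 60 + cost (reg r_item) + 10) \<le> X * (172 * X)"
      using *(2) N X by (intro mult_mono) auto
    also have "\<dots> = 172 * X^2" by (simp add: power2_eq_square)
    also have "\<dots> + 10 \<le> 400 * X^2" using X one_le_power[of X 2] by linarith
    finally have "t \<le> 400 * X ^ 2" using 4(2) by simp
    then show ?case using 4 * by auto
  qed
  show ?thesis
    unfolding gen_com_def wp_Seq[of _ "Store _ _"] wp_Store inner_def[symmetric]
  proof (rule wp_For[where n = N and b = "400 * X^2 + 100" and J = "\<lambda>i M' out'. out' = out \<and>
     (\<forall>z. z < 3 \<or> (12 \<le> z \<and> (z < T \<or> T + N \<le> z)) \<longrightarrow> M' z = M z) \<and>
     M' r_item = i \<and> M' r_adr = 4 + i * S \<and>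
     (\<forall>i'<i. M' (T + i') = fst (?g i) i') \<and> M' r_next = snd (?g i)"], goal_cases)
    case 1
    then show ?case by simp
  next
    case (2 j M2 out2)
    then show ?case using cnt by simp
  next
    case (3 i M2 out2)
    obtain f p where fp: "?g i = (f, p)" by force
    have M2: "M2 4 = i" "M2 3 = p" "M2 5 = 4 + i * S" "\<And>z. M2 (B + z) = of_bool (w z)"
      "\<And>i'. i' < i \<Longrightarrow> M2 (T + i') = f i'"
      using 3 fp T w by (auto simp: B_def)
    have "out2 = out" using 3(1) by simp
    show ?case unfolding wp_Seq wp_Store \<open>out2 = out\<close>
    proof (rule inner[of _ i p f], goal_cases)
      case (8 t M3)
      note t = 8(1) and q = 8(3)
      have M3: "M3 z = M2 z" if "z < 6 \<or> 12 \<le> z" for z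
        using 8(2) that by auto
      have "M3 3 = p" "M3 4 = i" "M3 5 = 4 + i * S" "\<And>i'. i' < i \<Longrightarrow> M3 (T + i') = f i'"
        using M2 M3 T(1) by simp_all
      moreover have "M3 z = M z" if "z < 3 \<or> (12 \<le> z \<and> (z < T \<or> T + N \<le> z))" for z
        using 3(1) M3[of z] that by auto
      ultimately show ?case
        using t q fp tab step T 3 by (simp add: less_Suc_eq)
    qed (use M2 3(2) T in \<open>simp_all add: B_def\<close>)
  next
    case (4 t M2 out2)
    have "N * (400 * X^2 + 100 + cost cnt + 10) \<le> X * (513 * X^2)"
      using N cnt one_le_power[OF X, of 2] by (intro mult_mono) linarith+
    also have "\<dots> = 513 * X^3" by (simp add: power2_eq_square power3_eq_cube)
    finally have "t + 3 \<le> 2000 * X ^ 3"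
      using 4(2) cnt(2) X one_le_power[of X 3] by linarith
    then show ?case using 4(1) by (auto intro!: post)
  qed
qed

section \<open>Every solvable instance has a short description\<close>

text \<open>Correctness of the decoder needs only this dichotomy, not which of several matching
  earlier items is chosen.\<close>

lemma pick_cases:
  obtains (copy) t' where "t' < t" "e t'" "w (f t' + r)" "pick w r e f p t = f t'"
  | (fresh) "\<And>t'. t' < t \<Longrightarrow> e t' \<Longrightarrow> \<not> w (f t' + r)" "pick w r e f p t = p"
proof -
  have "(\<exists>t'<t. e t' \<and> w (f t' + r) \<and> pick w r e f p t = f t') \<or>
    ((\<forall>t'<t. e t' \<longrightarrow> \<not> w (f t' + r)) \<and> pick w r e f p t = p)"
    by (induction t) (auto simp: less_Suc_eq)
  then show thesis using copy fresh by blast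
qed

text \<open>An item is a row or a column, and \<open>roles_of\<close> its role set in a given solution.\<close>

locale items =
  fixes sim :: "nat \<Rightarrow> nat \<Rightarrow> bool" and exact :: "nat \<Rightarrow> bool"
    and roles_of :: "nat \<Rightarrow> nat \<Rightarrow> bool" and r N :: nat
  assumes sim_trans: "sim t t' \<Longrightarrow> sim t' t'' \<Longrightarrow> sim t t''"
    and exact_sim: "t < N \<Longrightarrow> t' < N \<Longrightarrow> exact t \<Longrightarrow> exact t' \<Longrightarrow>
      (\<And>l. l < r \<Longrightarrow> roles_of t l = roles_of t' l) \<Longrightarrow> sim t t'"
begin

text \<open>An item that is not new gets no block even if it is inexact in the given solution: it
  copies an exact block as soon as one is available.\<close>

definition new :: "nat \<Rightarrow> bool" where
  "new t \<longleftrightarrow> (\<forall>t'<t. exact t' \<longrightarrow> \<not> sim t' t)"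

definition block :: "nat \<Rightarrow> bool list" where
  "block t = (if new t then map (roles_of t) [0..<r] @ [exact t] else [])"

definition code :: "nat \<Rightarrow> bool list" where
  "code t = concat (map block [0..<t])"

lemma code_Suc: "code (Suc t) = code t @ block t"
  by (simp add: code_def)

lemma code_prefix: "t \<le> t' \<Longrightarrow> \<exists>xs. code t' = code t @ xs"
  by (induction rule: dec_induct) (auto simp: code_Suc)

text \<open>Two new exact items with the same role set would be similar by \<open>exact_sim\<close>,
  contradicting newness of the later one. So the new exact items inject into the subsets of
  \<open>{..<r}\<close>, and the other new items are inexact.\<close>

lemma card_new_le:
  assumes "card {t. t < N \<and> \<not> exact t} \<le> k"
  shows "card {t. t < N \<and> new t} \<le> 2 ^ r + k"
proof -
  let ?S = "{t. t < N \<and> new t \<and> exact t}"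
  have "inj_on (\<lambda>t. {l. l < r \<and> roles_of t l}) ?S"
  proof (rule linorder_inj_onI)
    fix t t' assume *: "t < t'" "t \<in> ?S" "t' \<in> ?S"
    then have "\<not> sim t t'" by (auto simp: new_def)
    then show "{l. l < r \<and> roles_of t l} \<noteq> {l. l < r \<and> roles_of t' l}"
      using exact_sim[of t t'] * by auto
  qed auto
  then have "card ?S \<le> card (Pow {..<r})"
    by (rule card_inj_on_le) auto
  then have "card ?S + card {t. t < N \<and> \<not> exact t} \<le> 2 ^ r + k"
    using assms by (simp add: card_Pow)
  moreover have "card {t. t < N \<and> new t} \<le> card (?S \<union> {t. t < N \<and> \<not> exact t})"
    by (intro card_mono) auto
  ultimately show ?thesis using card_Un_le[of ?S "{t. t < N \<and> \<not> exact t}"] by linarith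
qed

lemma length_code: "length (code t) = Suc r * card {t'. t' < t \<and> new t'}"
proof (induction t)
  case (Suc t)
  have "{t'. t' < Suc t \<and> new t'} =
      (if new t then insert t {t'. t' < t \<and> new t'} else {t'. t' < t \<and> new t'})"
    by (auto simp: less_Suc_eq)
  then show ?case using Suc by (simp add: code_Suc block_def)
qed (simp add: code_def)

lemma length_code_le:
  assumes "card {t. t < N \<and> \<not> exact t} \<le> k"
  shows "length (code N) \<le> Suc r * (2 ^ r + k)"
  unfolding length_code by (intro mult_left_mono card_new_le assms) simp

text \<open>The block at offset \<open>q\<close> may belong to an earlier exact item
  \<open>t0\<close> similar to \<open>t\<close>; its last bit then speaks about \<open>t0\<close>,
  not about \<open>t\<close>.\<close>

definition represents :: "(nat \<Rightarrow> bool) \<Rightarrow> nat \<Rightarrow> nat \<Rightarrow> bool" where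
  "represents w q t \<longleftrightarrow> (\<exists>t0\<le>t. (t0 = t \<or> exact t0 \<and> sim t0 t) \<and>
     (\<forall>l<r. w (q + l) = roles_of t0 l) \<and> w (q + r) = exact t0)"

text \<open>The decoder decides from bits, the encoder from the solution; both agree. A copied block
  stems from an exact item that is similar to \<open>t\<close> by transitivity, so \<open>t\<close>
  is not new and the code holds no block for it. If nothing can be copied, no earlier exact item is
  similar to \<open>t\<close>, so \<open>t\<close> is new and its block comes next.\<close>

lemma gen_represents:
  assumes "t \<le> N" and w: "\<And>i. i < length (code N) \<Longrightarrow> w (p + i) = code N ! i"
  shows "snd (gen w r sim p t) = p + length (code t) \<and>
    (\<forall>t'<t. fst (gen w r sim p t) t' < p + length (code t) \<and>
      represents w (fst (gen w r sim p t) t') t')"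
  using assms(1)
proof (induction t)
  case 0
  then show ?case by (simp add: code_def)
next
  case (Suc t)
  obtain f p' where fp: "gen w r sim p t = (f, p')" by force
  from Suc fp have p': "p' = p + length (code t)"
    and f: "\<And>t'. t' < t \<Longrightarrow> f t' < p'" "\<And>t'. t' < t \<Longrightarrow> represents w (f t') t'" by auto
  show ?case
  proof (cases rule: pick_cases[where t = t and e = "\<lambda>t'. sim t' t" and w = w and f = f and r = r and p = p'])
    case (copy t')
    from f(2)[OF copy(1)] obtain t0 where t0: "t0 \<le> t'" "t0 = t' \<or> sim t0 t'"
      "\<forall>l<r. w (f t' + l) = roles_of t0 l" "w (f t' + r) = exact t0"
      unfolding represents_def by blast
    have "sim t0 t" using t0(2) copy(2) sim_trans by blast
    have "exact t0" using t0(4) copy(3) by simp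
    have "t0 \<le> t" "t0 < t" using t0(1) copy(1) by simp_all
    with \<open>exact t0\<close> \<open>sim t0 t\<close> have "\<not> new t" unfolding new_def by blast
    have "represents w (f t') t"
      unfolding represents_def using \<open>t0 \<le> t\<close> \<open>exact t0\<close> \<open>sim t0 t\<close> t0(3,4) by blast
    moreover have "gen w r sim p (Suc t) = (f(t := f t'), p')"
      using fp copy(4) f(1)[OF copy(1)] by (simp add: Let_def)
    ultimately show ?thesis
      using f p' copy(1) \<open>\<not> new t\<close> by (auto simp: code_Suc block_def less_Suc_eq)
  next
    case fresh
    have "new t" unfolding new_def
    proof (intro allI impI notI)
      fix t' assume t': "t' < t" "exact t'" "sim t' t"
      \<comment> \<open>The represented item is \<open>t'\<close> itself, exact by assumption, or
        another exact item; the flag is set in both cases.\<close>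
      then have "w (f t' + r)" using f(2)[OF t'(1)] unfolding represents_def by blast
      then show False using fresh(1) t' by blast
    qed
    then have blk: "block t = map (roles_of t) [0..<r] @ [exact t]" by (simp add: block_def)
    obtain xs where xs: "code N = (code t @ block t) @ xs"
      using code_prefix[OF Suc.prems] unfolding code_Suc by blast
    have "w (p' + l) = block t ! l" if "l \<le> r" for l
      using w[of "length (code t) + l"] that blk unfolding xs p'
      by (simp add: nth_append add.assoc)
    then have "represents w p' t"
      unfolding represents_def using blk by (intro exI[of _ t]) (simp add: nth_append)
    moreover have "gen w r sim p (Suc t) = (f(t := p'), Suc (p' + r))"
      using fp fresh(2) by (simp add: Let_def)
    moreover have "f t' < Suc (p' + r)" if "t' < t" for t' using f(1)[OF that] by simp
    ultimately show ?thesis using f(2) p' blk by (simp add: code_Suc All_less_Suc add.assoc)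
  qed
qed

end

section \<open>Guesses as natural numbers and access to the encoded input\<close>

lemma ex_nat_with_bits:
  assumes "length xs \<le> N"
  obtains v :: nat where "v < 2 ^ N" "\<And>i. i < length xs \<Longrightarrow> bit v i = xs ! i"
proof
  \<comment> \<open>Least significant bit first; the positions from \<open>length xs\<close> on are
    padded with zeros.\<close>
  let ?v = "horner_sum of_bool 2 xs :: nat"
  have "take_bit N ?v = ?v"
    using assms by (intro bit_eqI) (auto simp: bit_take_bit_iff bit_horner_sum_bit_iff)
  then show "?v < 2 ^ N" by (metis take_bit_nat_less_exp)
  show "bit ?v i = xs ! i" if "i < length xs" for i
    using that by (simp add: bit_horner_sum_bit_iff)
qed

lemma mat_words_length: "length (mat_words w A) = dim_row A * dim_col A"
  by (simp add: mat_words_def length_concat comp_def sum_list_triv)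

lemma index_less: "i < m \<Longrightarrow> j < n \<Longrightarrow> i * n + j < m * (n :: nat)"
  using mult_le_mono1[of "Suc i" m n] by simp

lemma mat_words_nth:
  assumes "i < dim_row A" "j < dim_col A"
  shows "mat_words w A ! (i * dim_col A + j) = w (A $$ (i, j))"
proof -
  have len: "length (concat (map (\<lambda>i. map (g i) [0..<n]) [0..<m])) = m * n"
    for g :: "nat \<Rightarrow> nat \<Rightarrow> nat" and m n
    by (simp add: length_concat comp_def sum_list_triv)
  have "concat (map (\<lambda>i. map (g i) [0..<n]) [0..<m]) ! (i * n + j) = g i j"
    if "i < m" "j < n" for g :: "nat \<Rightarrow> nat \<Rightarrow> nat" and m n
    using that(1)
  proof (induction m)
    case (Suc m)
    let ?xs = "concat (map (\<lambda>i. map (g i) [0..<n]) [0..<m])"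
    have split: "concat (map (\<lambda>i. map (g i) [0..<n]) [0..<Suc m]) = ?xs @ map (g m) [0..<n]"
      by simp
    show ?case
    proof (cases "i < m")
      case True
      then have "i * n + j < length ?xs" using index_less[OF True \<open>j < n\<close>] len by metis
      then show ?thesis using Suc.IH[OF True] unfolding split nth_append by argo
    next
      case False
      with Suc.prems have "i = m" by simp
      then have "i * n + j = length ?xs + j" using len by metis
      then have "(?xs @ map (g m) [0..<n]) ! (i * n + j) = map (g m) [0..<n] ! j"
        by (metis nth_append_length_plus)
      then show ?thesis unfolding split using \<open>i = m\<close> \<open>j < n\<close> by simp
    qed
  qed simp
  from this[OF assms, of "\<lambda>i j. w (A $$ (i, j))"] show ?thesis
    unfolding mat_words_def .
qed

definition input_word :: "gnrm \<Rightarrow> nat \<Rightarrow> nat" where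
  "input_word I = (\<lambda>i. if i < length (gnrm_input I) then gnrm_input I ! i else 0)"

lemma input_word_params [simp]:
  "input_word I 0 = dim_row (upa I)" "input_word I (Suc 0) = dim_col (upa I)"
  "input_word I 2 = noise I" "input_word I 3 = roles I"
  by (simp_all add: input_word_def gnrm_input_def numeral_2_eq_2 numeral_3_eq_3)

lemma input_word_upa:
  assumes "i < dim_row (upa I)" "j < dim_col (upa I)"
  shows "input_word I (4 + (i * dim_col (upa I) + j)) = of_bool (upa I $$ (i, j))"
  using mat_words_nth[OF assms, of of_bool] index_less[OF assms]
  by (simp add: input_word_def gnrm_input_def nth_append mat_words_length)

lemma input_word_labels:
  assumes "I \<in> gnrm_instances" "i < dim_row (upa I)" "j < dim_col (upa I)"
  shows "input_word I (4 + dim_row (upa I) * dim_col (upa I) + (i * dim_col (upa I) + j)) =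
    of_bool (labels I $$ (i, j) = Lab_Top)"
proof -
  have "dim_row (labels I) = dim_row (upa I)" "dim_col (labels I) = dim_col (upa I)"
    using assms(1) by (auto simp: gnrm_instances_def)
  then show ?thesis
    using mat_words_nth[of i "labels I" j "\<lambda>f. of_bool (f = Lab_Top)"] index_less[OF assms(2,3)] assms
    by (simp add: input_word_def gnrm_input_def nth_append mat_words_length)
qed

definition row_eq :: "gnrm \<Rightarrow> nat \<Rightarrow> nat \<Rightarrow> bool" where
  "row_eq I = item_eq (input_word I) (dim_col (upa I)) (dim_col (upa I)) 1"

definition col_eq :: "gnrm \<Rightarrow> nat \<Rightarrow> nat \<Rightarrow> bool" where
  "col_eq I = item_eq (input_word I) 1 (dim_row (upa I)) (dim_col (upa I))"

definition row_gen :: "gnrm \<Rightarrow> nat \<Rightarrow> (nat \<Rightarrow> nat) \<times> nat" where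
  "row_gen I v = gen (bit v) (roles I) (row_eq I) 0 (dim_row (upa I))"

text \<open>The columns read on where the rows stopped, so one string holds both codes without a
  separator.\<close>

definition col_gen :: "gnrm \<Rightarrow> nat \<Rightarrow> (nat \<Rightarrow> nat) \<times> nat" where
  "col_gen I v = gen (bit v) (roles I) (col_eq I) (snd (row_gen I v)) (dim_col (upa I))"

definition guess_UA :: "gnrm \<Rightarrow> nat \<Rightarrow> bool mat" where
  "guess_UA I v = mat (dim_row (upa I)) (roles I) (\<lambda>(i, l). bit v (fst (row_gen I v) i + l))"

definition guess_PA :: "gnrm \<Rightarrow> nat \<Rightarrow> bool mat" where
  "guess_PA I v = mat (roles I) (dim_col (upa I)) (\<lambda>(l, j). bit v (fst (col_gen I v) j + l))"

definition guess_prod :: "gnrm \<Rightarrow> nat \<Rightarrow> nat \<Rightarrow> nat \<Rightarrow> bool" where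
  "guess_prod I v i j \<longleftrightarrow>
     (\<exists>l<roles I. bit v (fst (row_gen I v) i + l) \<and> bit v (fst (col_gen I v) j + l))"

lemma guess_prod_eq:
  "i < dim_row (upa I) \<Longrightarrow> j < dim_col (upa I) \<Longrightarrow>
     (guess_UA I v \<and>\<^sub>m guess_PA I v) $$ (i, j) = guess_prod I v i j"
  by (auto simp: bool_mult_mat_def guess_UA_def guess_PA_def guess_prod_def)

lemma row_eq_iff:
  assumes "i < dim_row (upa I)" "i' < dim_row (upa I)"
  shows "row_eq I i i' \<longleftrightarrow> (\<forall>j<dim_col (upa I). upa I $$ (i, j) = upa I $$ (i', j))"
  using input_word_upa assms by (auto simp: row_eq_def item_eq_def add.assoc)

lemma col_eq_iff:
  assumes "j < dim_col (upa I)" "j' < dim_col (upa I)"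
  shows "col_eq I j j' \<longleftrightarrow> (\<forall>i<dim_row (upa I). upa I $$ (i, j) = upa I $$ (i, j'))"
proof -
  have "input_word I (4 + j * 1 + i * dim_col (upa I)) = of_bool (upa I $$ (i, j))"
    if "i < dim_row (upa I)" "j < dim_col (upa I)" for i j
  proof -
    have "4 + j * 1 + i * dim_col (upa I) = 4 + (i * dim_col (upa I) + j)" by simp
    then show ?thesis using input_word_upa[OF that] by metis
  qed
  with assms show ?thesis by (auto simp: col_eq_def item_eq_def)
qed

section \<open>From a solution to a guess of bounded length\<close>

lemma card_inexact_le:
  assumes sd: "sd F A B \<le> enat k"
  shows "card {i. i < dim_row A \<and> \<not> (\<forall>j<dim_col A. B $$ (i, j) = A $$ (i, j))} \<le> k"
    and "card {j. j < dim_col A \<and> \<not> (\<forall>i<dim_row A. B $$ (i, j) = A $$ (i, j))} \<le> k"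
proof -
  have entry: "sd_entry f a b \<ge> 1" if "b \<noteq> a" for f a b
    using that by (cases a; cases b) (auto simp: sd_entry_def one_enat_def)
  \<comment> \<open>Each bad row contains an entry of cost at least 1, and distinct rows share no
    entry. The double sum is kept general so that the columns follow by swapping the
    summations.\<close>
  have card: "card {i. i < m \<and> P i} \<le> k"
    if "(\<Sum>i<m. \<Sum>j<n. g i j) \<le> enat k" "\<And>i. i < m \<Longrightarrow> P i \<Longrightarrow> \<exists>j<n. g i j \<ge> 1"
    for m n P and g :: "nat \<Rightarrow> nat \<Rightarrow> enat"
  proof -
    note bad = that(2)
    have "enat (card {i. i < m \<and> P i}) = (\<Sum>i\<in>{i. i < m \<and> P i}. 1)"
      by (simp add: of_nat_eq_enat)
    also have "\<dots> \<le> (\<Sum>i\<in>{i. i < m \<and> P i}. \<Sum>j<n. g i j)"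
    proof (rule sum_mono)
      fix i assume "i \<in> {i. i < m \<and> P i}"
      then obtain j where "j < n" "g i j \<ge> 1" using bad by auto
      then show "1 \<le> (\<Sum>j<n. g i j)"
        using member_le_sum[of j "{..<n}" "g i"] by (auto intro: order_trans)
    qed
    also have "\<dots> \<le> (\<Sum>i<m. \<Sum>j<n. g i j)" by (intro sum_mono2) auto
    also note that(1)
    finally show ?thesis by simp
  qed
  show "card {i. i < dim_row A \<and> \<not> (\<forall>j<dim_col A. B $$ (i, j) = A $$ (i, j))} \<le> k"
    using entry by (intro card[OF sd[unfolded sd_def]]) (meson not_le)
  show "card {j. j < dim_col A \<and> \<not> (\<forall>i<dim_row A. B $$ (i, j) = A $$ (i, j))} \<le> k"
    using entry by (intro card[OF sd[unfolded sd_def sum.swap[of _ "{..<dim_col A}"]]]) (meson not_le)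
qed

lemma bool_mult_mat_index:
  assumes "A \<in> carrier_mat m r" "B \<in> carrier_mat r n" "i < m" "j < n"
  shows "(A \<and>\<^sub>m B) $$ (i, j) \<longleftrightarrow> (\<exists>l<r. A $$ (i, l) \<and> B $$ (l, j))"
  using assms by (auto simp: bool_mult_mat_def)

text \<open>Rows and columns need \<open>Suc r * (2 ^ r + k)\<close> bits each, and
  \<open>Suc r \<le> 2 * r\<close> because \<open>r \<ge> 1\<close>. The factor 4 can be computed by
  two doublings.\<close>

definition bit_count :: "gnrm \<Rightarrow> nat" where
  "bit_count I = 4 * (roles I * 2 ^ roles I) + 4 * (roles I * noise I)"

lemma solution_has_guess:
  assumes I: "I \<in> gnrm_instances" and sol: "gnrm_solution I UA PA"
  obtains v where "v < 2 ^ bit_count I" "gnrm_solution I (guess_UA I v) (guess_PA I v)"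
proof -
  let ?m = "dim_row (upa I)" and ?n = "dim_col (upa I)" and ?r = "roles I" and ?k = "noise I"
  let ?P = "UA \<and>\<^sub>m PA"
  have UA: "UA \<in> carrier_mat ?m ?r" and PA: "PA \<in> carrier_mat ?r ?n"
    and sd: "sd (labels I) (upa I) ?P \<le> enat ?k"
    using sol by (auto simp: gnrm_solution_def)
  note prod = bool_mult_mat_index[OF UA PA]
  define exr where "exr = (\<lambda>i. \<forall>j<?n. ?P $$ (i, j) = upa I $$ (i, j))"
  define exc where "exc = (\<lambda>j. \<forall>i<?m. ?P $$ (i, j) = upa I $$ (i, j))"
  interpret R: items "row_eq I" exr "\<lambda>i l. UA $$ (i, l)" ?r ?m
  proof
    fix i i' assume "i < ?m" "i' < ?m" "exr i" "exr i'"
      "\<And>l. l < ?r \<Longrightarrow> UA $$ (i, l) = UA $$ (i', l)"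
    moreover from this have "?P $$ (i, j) = ?P $$ (i', j)" if "j < ?n" for j
      using that by (auto simp: prod)
    ultimately show "row_eq I i i'" by (simp add: row_eq_iff exr_def)
  qed (auto simp: row_eq_def item_eq_def)
  interpret C: items "col_eq I" exc "\<lambda>j l. PA $$ (l, j)" ?r ?n
  proof
    fix j j' assume "j < ?n" "j' < ?n" "exc j" "exc j'"
      "\<And>l. l < ?r \<Longrightarrow> PA $$ (l, j) = PA $$ (l, j')"
    moreover from this have "?P $$ (i, j) = ?P $$ (i, j')" if "i < ?m" for i
      using that by (auto simp: prod)
    ultimately show "col_eq I j j'" by (simp add: col_eq_iff exc_def)
  qed (auto simp: col_eq_def item_eq_def)
  have "length (R.code ?m @ C.code ?n) \<le> 2 * (Suc ?r * (2 ^ ?r + ?k))"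
    using R.length_code_le[of ?k] C.length_code_le[of ?k] card_inexact_le[OF sd]
    unfolding exr_def exc_def by simp
  also have "\<dots> \<le> 2 * (2 * ?r * (2 ^ ?r + ?k))"
    using I by (intro mult_le_mono) (auto simp: gnrm_instances_def)
  also have "\<dots> = bit_count I" by (simp add: bit_count_def algebra_simps)
  finally have len: "length (R.code ?m @ C.code ?n) \<le> bit_count I" .
  obtain v :: nat where v: "v < 2 ^ bit_count I"
    "\<And>i. i < length (R.code ?m @ C.code ?n) \<Longrightarrow> bit v i = (R.code ?m @ C.code ?n) ! i"
    by (rule ex_nat_with_bits[OF len]) (rule that)
  have R: "snd (row_gen I v) = length (R.code ?m)"
    "\<And>i. i < ?m \<Longrightarrow> R.represents (bit v) (fst (row_gen I v) i) i"
    unfolding row_gen_def using R.gen_represents[of ?m "bit v" 0] v(2) by (auto simp: nth_append)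
  have C: "\<And>j. j < ?n \<Longrightarrow> C.represents (bit v) (fst (col_gen I v) j) j"
    unfolding col_gen_def R(1) using C.gen_represents[of ?n "bit v" "length (R.code ?m)"] v(2)
    by (auto simp: nth_append)
  let ?G = "guess_UA I v \<and>\<^sub>m guess_PA I v"
  have G: "guess_UA I v \<in> carrier_mat ?m ?r" "guess_PA I v \<in> carrier_mat ?r ?n"
    by (simp_all add: guess_UA_def guess_PA_def)
  have entry: "?G $$ (i, j) = upa I $$ (i, j) \<or> ?G $$ (i, j) = ?P $$ (i, j)"
    if ij: "i < ?m" "j < ?n" for i j
  proof -
    obtain i0 where i0: "i0 < ?m" "i0 = i \<or> exr i0 \<and> row_eq I i0 i"
      "\<forall>l<?r. bit v (fst (row_gen I v) i + l) = UA $$ (i0, l)"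
      using R(2)[OF ij(1)] ij(1) unfolding R.represents_def by (blast intro: le_less_trans)
    obtain j0 where j0: "j0 < ?n" "j0 = j \<or> exc j0 \<and> col_eq I j0 j"
      "\<forall>l<?r. bit v (fst (col_gen I v) j + l) = PA $$ (l, j0)"
      using C[OF ij(2)] ij(2) unfolding C.represents_def by (blast intro: le_less_trans)
    have "?G $$ (i, j) \<longleftrightarrow> (\<exists>l<?r. UA $$ (i0, l) \<and> PA $$ (l, j0))"
      using i0(3) j0(3) guess_prod_eq[OF ij] by (auto simp: guess_prod_def)
    also have "\<dots> \<longleftrightarrow> ?P $$ (i0, j0)" using i0(1) j0(1) by (simp add: prod)
    finally have "?G $$ (i, j) = ?P $$ (i0, j0)" .
    \<comment> \<open>Exactness of row \<open>i0\<close> is used once, to pass from the product to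
      \<open>upa I\<close>; the similarities then move within \<open>upa I\<close>, whether or not
      the column was replaced.\<close>
    moreover have "?P $$ (i0, j0) = upa I $$ (i, j)" if "exr i0" "row_eq I i0 i"
    proof -
      have "?P $$ (i0, j0) = upa I $$ (i0, j0)" using that j0(1) by (simp add: exr_def)
      also have "\<dots> = upa I $$ (i, j0)" using that i0(1) j0(1) ij by (simp add: row_eq_iff)
      also have "\<dots> = upa I $$ (i, j)" using j0(1,2) ij by (auto simp: col_eq_iff)
      finally show ?thesis .
    qed
    moreover have "?P $$ (i, j0) = upa I $$ (i, j)" if "exc j0" "col_eq I j0 j"
      using that j0(1) ij by (simp add: exc_def col_eq_iff)
    ultimately show ?thesis using i0(2) j0(2) by metis
  qed
  have "sd (labels I) (upa I) ?G \<le> sd (labels I) (upa I) ?P"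
    unfolding sd_def
  proof (intro sum_mono)
    fix i j assume "i \<in> {..<?m}" "j \<in> {..<?n}"
    then show "sd_entry (labels I $$ (i, j)) (upa I $$ (i, j)) (?G $$ (i, j))
      \<le> sd_entry (labels I $$ (i, j)) (upa I $$ (i, j)) (?P $$ (i, j))"
      using entry[of i j] by (auto simp: sd_entry_def)
  qed
  with sd G have "gnrm_solution I (guess_UA I v) (guess_PA I v)"
    by (auto simp: gnrm_solution_def)
  with v(1) that show thesis by blast
qed

section \<open>Checking a guess\<close>

abbreviation (input) r_row :: nat where "r_row \<equiv> 4"
abbreviation (input) r_col :: nat where "r_col \<equiv> 5"
abbreviation (input) r_role :: nat where "r_role \<equiv> 6"
abbreviation (input) r_hit :: nat where "r_hit \<equiv> 7"
abbreviation (input) r_entry :: nat where "r_entry \<equiv> 8"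
abbreviation (input) r_cost :: nat where "r_cost \<equiv> 9"

abbreviation row_tab :: exp where "row_tab \<equiv> Const 20"
abbreviation col_tab :: exp where "col_tab \<equiv> Add (Const 20) in_m"

abbreviation (input) role_bit :: "exp \<Rightarrow> nat \<Rightarrow> nat \<Rightarrow> exp" where
  "role_bit tab t l \<equiv> Mem (Add bits_base (Add (Mem (Add tab (reg t))) (reg l)))"

text \<open>All positions are covered, so reading beyond the intended string is harmless: it yields
  the higher bits of \<open>v\<close>.\<close>

definition bits_at :: "gnrm \<Rightarrow> (nat \<Rightarrow> nat) \<Rightarrow> nat \<Rightarrow> bool" where
  "bits_at I M v \<longleftrightarrow>
     (\<forall>z. M (20 + (dim_row (upa I) + dim_col (upa I)) + z) = of_bool (bit v z))"

definition tabs_at :: "gnrm \<Rightarrow> (nat \<Rightarrow> nat) \<Rightarrow> nat \<Rightarrow> bool" where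
  "tabs_at I M v \<longleftrightarrow>
     (\<forall>i<dim_row (upa I). M (20 + i) = fst (row_gen I v) i) \<and>
     (\<forall>j<dim_col (upa I). M (20 + dim_row (upa I) + j) = fst (col_gen I v) j)"

lemma frame_bits_tabs:
  assumes "\<And>z. 20 \<le> z \<Longrightarrow> M' z = M z"
  shows "bits_at I M' v = bits_at I M v" "tabs_at I M' v = tabs_at I M v"
  using assms by (simp_all add: bits_at_def tabs_at_def)

definition hit_com :: com where
  "hit_com =
     r_hit ::= Const 0 ;;
     For r_role in_r
       (If (role_bit row_tab r_row r_role)
          (If (role_bit col_tab r_col r_role) (r_hit ::= Const 1) Skip) Skip)"

lemma wp_hit_com:
  assumes "bits_at I M v" "tabs_at I M v" "M r_row = i" "M r_col = j"
    "i < dim_row (upa I)" "j < dim_col (upa I)" "roles I < X"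
    and post: "\<And>t M'. t \<le> 100 * X \<Longrightarrow> \<forall>z. z < 6 \<or> 8 \<le> z \<longrightarrow> M' z = M z \<Longrightarrow>
      M' r_hit = of_bool (guess_prod I v i j) \<Longrightarrow> Q t M' out"
  shows "wp (input_word I) hit_com Q M out"
  unfolding hit_com_def wp_Seq wp_Store
proof (rule wp_For[where n = "roles I" and b = 50 and J = "\<lambda>l M' out'. out' = out \<and>
    (\<forall>z. z < 6 \<or> 8 \<le> z \<longrightarrow> M' z = M z) \<and> M' r_role = l \<and> M' r_hit =
      of_bool (\<exists>l'<l. bit v (fst (row_gen I v) i + l') \<and> bit v (fst (col_gen I v) j + l'))"],
    goal_cases)
  case 1
  then show ?case by simp
next
  case (2 l M1 out1)
  then show ?case by simp
next
  case (3 l M1 out1)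
  have *: "\<And>z. 20 \<le> z \<Longrightarrow> M1 z = M z" using 3(1) by simp
  have "bits_at I M1 v" "tabs_at I M1 v" using assms(1,2) frame_bits_tabs[OF *] by simp_all
  moreover have "M1 r_row = i" "M1 r_col = j" using 3(1) assms(3,4) by simp_all
  ultimately show ?case using 3 assms(5,6)
    by (auto simp: bits_at_def tabs_at_def add.assoc less_Suc_eq)
next
  case (4 t M1 out1)
  have "t + 6 \<le> 100 * X" using 4(2) assms(7) by simp
  with 4(1) show ?case by (auto simp: guess_prod_def intro!: post)
qed

text \<open>A machine number has to replace the infinite cost; \<open>Suc (noise I)\<close> exceeds
  the budget on its own.\<close>

definition penalty :: "gnrm \<Rightarrow> nat \<Rightarrow> nat \<Rightarrow> nat \<Rightarrow> nat" where
  "penalty I v i j =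
     (if guess_prod I v i j = upa I $$ (i, j) then 0
      else if labels I $$ (i, j) = Lab_Top then 1 else Suc (noise I))"

text \<open>One forbidden change makes the distance infinite and the penalties exceed the budget.
  Without forbidden changes, distance and penalty agree entry by entry.\<close>

lemma guess_solution_iff:
  "gnrm_solution I (guess_UA I v) (guess_PA I v) \<longleftrightarrow>
     (\<Sum>i<dim_row (upa I). \<Sum>j<dim_col (upa I). penalty I v i j) \<le> noise I"
proof -
  let ?m = "dim_row (upa I)" and ?n = "dim_col (upa I)"
  define s where "s = (\<lambda>i j. sd_entry (labels I $$ (i, j)) (upa I $$ (i, j)) (guess_prod I v i j))"
  have sd: "gnrm_solution I (guess_UA I v) (guess_PA I v) \<longleftrightarrow>
      (\<Sum>i<?m. \<Sum>j<?n. s i j) \<le> enat (noise I)"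
    by (simp add: gnrm_solution_def sd_def s_def guess_prod_eq) (simp add: guess_UA_def guess_PA_def)
  show ?thesis
  proof (cases "\<exists>i<?m. \<exists>j<?n. guess_prod I v i j \<noteq> upa I $$ (i, j) \<and> labels I $$ (i, j) = Lab_Bot")
    case True
    then obtain i j where *: "i < ?m" "j < ?n" "guess_prod I v i j \<noteq> upa I $$ (i, j)"
      "labels I $$ (i, j) = Lab_Bot" by blast
    then have ij: "i < ?m" "j < ?n" "s i j = \<infinity>" "penalty I v i j = Suc (noise I)"
      by (auto simp: s_def sd_entry_def penalty_def)
    have "s i j \<le> (\<Sum>j<?n. s i j)" using ij by (intro member_le_sum) auto
    also have "\<dots> \<le> (\<Sum>i<?m. \<Sum>j<?n. s i j)"
      using ij by (intro member_le_sum[of i _ "\<lambda>i. \<Sum>j<?n. s i j"]) auto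
    finally have "(\<Sum>i<?m. \<Sum>j<?n. s i j) = \<infinity>" using ij by simp
    moreover have "penalty I v i j \<le> (\<Sum>j<?n. penalty I v i j)"
      using ij by (intro member_le_sum) auto
    moreover have "\<dots> \<le> (\<Sum>i<?m. \<Sum>j<?n. penalty I v i j)"
      using ij by (intro member_le_sum[of i _ "\<lambda>i. \<Sum>j<?n. penalty I v i j"]) auto
    ultimately show ?thesis using ij(4) unfolding sd by simp
  next
    case False
    have "s i j = of_nat (penalty I v i j)" if "i < ?m" "j < ?n" for i j
    proof -
      have "labels I $$ (i, j) = Lab_Top" if "guess_prod I v i j \<noteq> upa I $$ (i, j)"
        using False that \<open>i < ?m\<close> \<open>j < ?n\<close> by (metis label.exhaust)
      then show ?thesis
        by (auto simp: s_def sd_entry_def penalty_def enat_0 one_enat_def)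
    qed
    then have "(\<Sum>i<?m. \<Sum>j<?n. s i j) = of_nat (\<Sum>i<?m. \<Sum>j<?n. penalty I v i j)"
      by simp
    then show ?thesis unfolding sd of_nat_eq_enat by simp
  qed
qed

definition check_com :: com where
  "check_com =
     r_cost ::= Const 0 ;;
     r_entry ::= Const 0 ;;
     For r_row in_m (
       For r_col in_n (
         hit_com ;;
         If (Add (Sub (Input (Add (Const 4) (reg r_entry))) (reg r_hit))
                 (Sub (reg r_hit) (Input (Add (Const 4) (reg r_entry)))))
           (If (Input (Add (reg r_lab) (reg r_entry)))
              (r_cost ::= Add (reg r_cost) (Const 1))
              (r_cost ::= Add (reg r_cost) (Add in_k (Const 1))))
           Skip ;;
         r_entry ::= Add (reg r_entry) (Const 1)))"

lemma wp_check_com: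
  assumes I: "I \<in> gnrm_instances" and M: "bits_at I M v" "tabs_at I M v"
    and lab: "M r_lab = 4 + dim_row (upa I) * dim_col (upa I)"
    and X: "dim_row (upa I) < X" "dim_col (upa I) < X" "roles I < X"
    and post: "\<And>t M'. t \<le> 1000 * X ^ 3 \<Longrightarrow> \<forall>z. z < 4 \<or> 20 \<le> z \<longrightarrow> M' z = M z \<Longrightarrow>
      M' r_cost \<le> noise I \<longleftrightarrow> gnrm_solution I (guess_UA I v) (guess_PA I v) \<Longrightarrow> Q t M' out"
  shows "wp (input_word I) check_com Q M out"
proof -
  let ?m = "dim_row (upa I)" and ?n = "dim_col (upa I)"
  let ?frame = "\<lambda>M'. \<forall>z. z < 4 \<or> 20 \<le> z \<longrightarrow> M' z = M z"
  have X1: "X \<ge> 1" using X by simp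
  show ?thesis unfolding check_com_def wp_Seq[of _ "Store _ _"] wp_Store
  proof (rule wp_For[where n = ?m and b = "300 * X ^ 2" and J = "\<lambda>i M' out'. out' = out \<and>
      ?frame M' \<and> M' r_row = i \<and> M' r_entry = i * ?n \<and>
      M' r_cost = (\<Sum>i'<i. \<Sum>j<?n. penalty I v i' j)"], goal_cases)
    case 1
    then show ?case by simp
  next
    case (2 i M1 out1)
    then show ?case by simp
  next
    case (3 i M1 out1)
    show ?case
    proof (rule wp_For[where n = ?n and b = "100 * X + 60" and J = "\<lambda>j M' out'. out' = out \<and>
      ?frame M' \<and> M' r_row = i \<and> M' r_col = j \<and> M' r_entry = i * ?n + j \<and>
      M' r_cost = (\<Sum>i'<i. \<Sum>j<?n. penalty I v i' j) + (\<Sum>j'<j. penalty I v i j')"], goal_cases)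
      case 1
      then show ?case using 3 by simp
    next
      case (2 j M2 out2)
      then show ?case by simp
    next
      case (3 j M2 out2)
      have bt: "bits_at I M2 v" "tabs_at I M2 v" using M frame_bits_tabs[of M2 M] 3(1) by simp_all
      have M2: "out2 = out" "M2 r_row = i" "M2 r_col = j" using 3(1) by simp_all
      show ?case unfolding wp_Seq \<open>out2 = out\<close>
      proof (rule wp_hit_com[OF bt M2(2,3) \<open>i < ?m\<close> \<open>j < ?n\<close> X(3)], goal_cases)
        case (1 t M3)
        have M3: "\<And>z. z < 4 \<or> 20 \<le> z \<Longrightarrow> M3 z = M z" "M3 r_row = i" "M3 r_col = j"
          "M3 r_entry = i * ?n + j"
          "M3 r_cost = (\<Sum>i'<i. \<Sum>j<?n. penalty I v i' j) + (\<Sum>j'<j. penalty I v i j')"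
          using 3(1) 1(2) by auto
        note in1 = input_word_upa[OF \<open>i < ?m\<close> \<open>j < ?n\<close>]
          input_word_labels[OF I \<open>i < ?m\<close> \<open>j < ?n\<close>]
        show ?case
          using M3 1(1,3) in1 lab
          by (auto simp: penalty_def add.assoc)
      qed
    next
      case (4 t M2 out2)
      have "?n * (100 * X + 60 + cost in_n + 10) \<le> X * (172 * X)"
        using X X1 by (intro mult_mono) auto
      also have "\<dots> = 172 * X^2" by (simp add: power2_eq_square)
      also have "\<dots> + 20 \<le> 300 * X^2" using one_le_power[OF X1, of 2] by linarith
      finally have "t \<le> 300 * X ^ 2" using 4(2) by simp
      then show ?case using 4(1) by simp
    qed
  next
    case (4 t M1 out1)
    have "?m * (300 * X^2 + cost in_m + 10) \<le> X * (312 * X^2)"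
      using X one_le_power[OF X1, of 2] by (intro mult_mono) auto
    also have "\<dots> = 312 * X^3" by (simp add: power2_eq_square power3_eq_cube)
    finally have "t + 6 \<le> 1000 * X ^ 3" using 4(2) one_le_power[OF X1, of 3] by simp
    then show ?case using 4(1) by (auto simp: guess_solution_iff intro!: post)
  qed
qed

section \<open>The binary counter\<close>

definition inc_com :: com where
  "inc_com =
     4 ::= bits_base ;;
     While (Mem (reg 4)) (
       Store (reg 4) (Const 0) ;;
       4 ::= Add (reg 4) (Const 1)) ;;
     Store (reg 4) (Const 1)"

text \<open>Here \<open>z\<close> is the lowest zero bit: the carry clears the ones below it and
  stops there. Induction on \<open>z\<close> halves \<open>v\<close>, using
  \<open>Suc v div 2 = Suc (v div 2)\<close> for odd \<open>v\<close>.\<close>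

lemma bit_Suc_nat:
  fixes v :: nat
  assumes "\<And>i. i < z \<Longrightarrow> bit v i" "\<not> bit v z"
  shows "bit (Suc v) i \<longleftrightarrow> i = z \<or> z < i \<and> bit v i"
  using assms
proof (induction z arbitrary: v i)
  case 0
  then have "even v" by (simp add: bit_0)
  then show ?case by (cases i) (auto simp: bit_0 bit_Suc)
next
  case (Suc z)
  have "odd v" using Suc.prems(1)[of 0] by (simp add: bit_0)
  then have "Suc v div 2 = Suc (v div 2)" by presburger
  moreover have "bit (v div 2) i" if "i < z" for i
    using Suc.prems(1)[of "Suc i"] that by (simp add: bit_Suc)
  moreover have "\<not> bit (v div 2) z" using Suc.prems(2) by (simp add: bit_Suc)
  ultimately have "bit (Suc (v div 2)) j \<longleftrightarrow> j = z \<or> z < j \<and> bit (v div 2) j" for j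
    using Suc.IH by blast
  then show ?case using \<open>odd v\<close> \<open>Suc v div 2 = Suc (v div 2)\<close>
    by (cases i) (auto simp: bit_0 bit_Suc)
qed

lemma bit_less_power: "(v :: nat) < 2 ^ N \<Longrightarrow> bit v i \<Longrightarrow> i < N"
  by (metis bit_take_bit_iff take_bit_nat_eq_self)

text \<open>As \<open>v < 2 ^ N\<close>, the run of trailing ones has length at most
  \<open>N\<close>. This worst case is charged to every increment, without amortisation.
  \<open>Suc v\<close> may reach \<open>2 ^ N\<close>, which sets bit \<open>N\<close>.\<close>

lemma wp_inc_com:
  assumes M: "bits_at I M v" and v: "v < 2 ^ N"
    and post: "\<And>t M'. t \<le> 100 * Suc N \<Longrightarrow> \<forall>z. z < 4 \<longrightarrow> M' z = M z \<Longrightarrow>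
      bits_at I M' (Suc v) \<Longrightarrow> Q t M' out"
  shows "wp (input_word I) inc_com Q M out"
proof -
  let ?B = "20 + (dim_row (upa I) + dim_col (upa I))"
  show ?thesis unfolding inc_com_def wp_Seq wp_Store
  proof (rule wp_While[where n = N and b = 20 and i = 0 and J = "\<lambda>i M' out'. out' = out \<and>
      (\<forall>z. z < 4 \<longrightarrow> M' z = M z) \<and> M' 4 = ?B + i \<and> (\<forall>j<i. bit v j) \<and>
      (\<forall>z. M' (?B + z) = of_bool (i \<le> z \<and> bit v z))"], goal_cases)
    case 1
    then show ?case using M by (simp add: bits_at_def)
  next
    case (2 i M1 out1)
    then have "M1 (?B + i) \<noteq> 0" by simp
    then have "bit v i" using 2(1) by auto
    then show ?case using 2 bit_less_power[OF v] by (auto simp: less_Suc_eq)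
  next
    case (3 i M1 out1 t)
    then have "M1 (?B + i) = 0" by simp
    then have "\<not> bit v i" using 3(1) by auto
    then have "bit (Suc v) z \<longleftrightarrow> z = i \<or> i < z \<and> bit v z" for z
      using bit_Suc_nat[of i v z] 3(1) by blast
    then show ?case using 3 by (auto intro!: post simp: bits_at_def)
  qed
qed

section \<open>Output of a matrix\<close>

definition write_mat :: "nat \<Rightarrow> exp \<Rightarrow> nat \<Rightarrow> exp \<Rightarrow> exp \<Rightarrow> com" where
  "write_mat x ex y ey e = For x ex (For y ey (Write e))"

text \<open>The bound 20 is exactly the cost of reading a role bit through the column table.\<close>

lemma wp_write_mat:
  assumes ex: "\<And>M. eval inp M ex = a" "cost ex \<le> 2" and ey: "\<And>M. eval inp M ey = b" "cost ey \<le> 2"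
    and "x \<noteq> y" "a < X" "b < X"
    and e: "\<And>M' i j. \<forall>z. z \<noteq> x \<and> z \<noteq> y \<longrightarrow> M' z = M z \<Longrightarrow> M' x = i \<Longrightarrow> M' y = j \<Longrightarrow>
      i < a \<Longrightarrow> j < b \<Longrightarrow> eval inp M' e = g i j" "cost e \<le> 20"
    and post: "\<And>t M'. t \<le> 100 * X ^ 2 \<Longrightarrow> \<forall>z. z \<noteq> x \<and> z \<noteq> y \<longrightarrow> M' z = M z \<Longrightarrow>
      Q t M' (out @ concat (map (\<lambda>i. map (g i) [0..<b]) [0..<a]))"
  shows "wp inp (write_mat x ex y ey e) Q M out"
  unfolding write_mat_def
proof (rule wp_For[where n = a and b = "50 * X" and J = "\<lambda>i M' out'.
    out' = out @ concat (map (\<lambda>i. map (g i) [0..<b]) [0..<i]) \<and>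
    (\<forall>z. z \<noteq> x \<and> z \<noteq> y \<longrightarrow> M' z = M z) \<and> M' x = i"], goal_cases)
  case 1
  then show ?case by simp
next
  case (2 i M1 out1)
  then show ?case using ex by simp
next
  case (3 i M1 out1)
  show ?case
  proof (rule wp_For[where n = b and b = 21 and J = "\<lambda>j M' out'.
      out' = out1 @ map (g i) [0..<j] \<and>
      (\<forall>z. z \<noteq> x \<and> z \<noteq> y \<longrightarrow> M' z = M z) \<and> M' x = i \<and> M' y = j"], goal_cases)
    case 1
    then show ?case using 3 \<open>x \<noteq> y\<close> by simp
  next
    case (2 j M2 out2)
    then show ?case using ey by simp
  next
    case (3 j M2 out2)
    then show ?case using e(1)[of M2 i j] e(2) \<open>x \<noteq> y\<close> \<open>i < a\<close> by simp
  next
    case (4 t M2 out2)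
    have "b * (21 + cost ey + 10) \<le> b * 33" using ey by (intro mult_left_mono) auto
    then have "t \<le> 50 * X" using 4(2) ey(2) \<open>b < X\<close> by linarith
    then show ?case using 4(1) 3(1) by simp
  qed
next
  case (4 t M1 out1)
  have "a * (50 * X + cost ex + 10) \<le> X * (62 * X)"
    using ex \<open>a < X\<close> by (intro mult_mono) auto
  also have "\<dots> = 62 * X^2" by (simp add: power2_eq_square)
  finally have "t \<le> 100 * X ^ 2" using 4(2) ex(2) \<open>a < X\<close> one_le_power[of X 2] by linarith
  then show ?case using 4(1) post[of t M1] by simp
qed

section \<open>The program\<close>

text \<open>Register 4 runs through \<open>i * 2 ^ i\<close>, which avoids a multiplication.\<close>

definition init_com :: com where
  "init_com =
     3 ::= Const 1 ;;
     4 ::= Const 0 ;;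
     5 ::= Const 0 ;;
     For 6 in_r (
       3 ::= Add (reg 3) (reg 3) ;;
       4 ::= Add (reg 4) (Add (reg 4) (reg 3)) ;;
       5 ::= Add (reg 5) in_k) ;;
     6 ::= Add (reg 4) (reg 5) ;;
     r_end ::= Add bits_base (Add (Add (reg 6) (reg 6)) (Add (reg 6) (reg 6)))"

text \<open>Register 4 is updated by
  \<open>(i + 1) * 2 ^ (i + 1) = i * 2 ^ i + i * 2 ^ i + 2 ^ (i + 1)\<close>, where register 3
  supplies the last power. Cells from 20 on are still zero and thus already hold the guess
  0.\<close>

lemma wp_init_com:
  assumes post: "\<And>t M. t \<le> 100 * Suc (roles I) \<Longrightarrow>
      M r_end = 20 + (dim_row (upa I) + dim_col (upa I)) + bit_count I \<Longrightarrow>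
      M r_found = 0 \<Longrightarrow> bits_at I M 0 \<Longrightarrow> Q t M []"
  shows "wp (input_word I) init_com Q (\<lambda>_. 0) []"
  unfolding init_com_def wp_Seq wp_Store
proof (rule wp_For[where n = "roles I" and b = 40 and J = "\<lambda>i M out. out = [] \<and>
    M 6 = i \<and> M 3 = 2 ^ i \<and> M 4 = i * 2 ^ i \<and> M 5 = i * noise I \<and> M r_found = 0 \<and>
    (\<forall>z\<ge>20. M z = 0)"], goal_cases)
  case 1
  then show ?case by simp
next
  case (2 i M out)
  then show ?case by simp
next
  case (3 i M out)
  then show ?case by simp
next
  case (4 t M out)
  then show ?case by (auto simp: bit_count_def bits_at_def intro!: post)
qed

text \<open>While the rows are decoded, \<open>r_adr\<close> runs up to \<open>4 + m * n\<close>,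
  the address of the first label word. Saving it in \<open>r_lab\<close> avoids a
  multiplication.\<close>

definition try_com :: com where
  "try_com =
     r_next ::= Const 0 ;;
     gen_com row_tab in_m in_n in_n (Const 1) ;;
     r_lab ::= reg r_adr ;;
     gen_com col_tab in_n (Const 1) in_m in_n ;;
     check_com ;;
     If (Sub (reg r_cost) in_k) inc_com (r_found ::= Const 1)"

abbreviation guess_ok :: "gnrm \<Rightarrow> nat \<Rightarrow> bool" where
  "guess_ok I v \<equiv> gnrm_solution I (guess_UA I v) (guess_PA I v)"

text \<open>Two decodings and one check take at most \<open>5000 * X ^ 3\<close> steps; the rest of
  the bound covers the increment and the register operations. After a success the counter is left
  alone, so that string and tables can be used for the output.\<close>

lemma wp_try_com:
  assumes I: "I \<in> gnrm_instances" and M: "bits_at I M v" "M r_found = 0" and v: "v < 2 ^ N"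
    and X: "X = dim_row (upa I) + dim_col (upa I) + roles I + 1"
    and post: "\<And>t M'. t \<le> 6000 * X ^ 3 + 100 * N \<Longrightarrow> M' r_end = M r_end \<Longrightarrow>
      (if guess_ok I v then M' r_found = 1 \<and> bits_at I M' v \<and> tabs_at I M' v
       else M' r_found = 0 \<and> bits_at I M' (Suc v)) \<Longrightarrow> Q t M' out"
  shows "wp (input_word I) try_com Q M out"
proof -
  let ?m = "dim_row (upa I)" and ?n = "dim_col (upa I)"
  have X1: "1 \<le> X ^ 3" unfolding X by simp
  show ?thesis unfolding try_com_def wp_Seq[of _ "Store _ _"] wp_Seq[of _ "gen_com _ _ _ _ _"] wp_Store
  proof (rule wp_gen_com[where w = "bit v" and X = X and T = 20 and N = ?m and S = ?n and L = ?n and D = 1],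
      goal_cases)
    case (16 t1 M1)
    have M1: "bits_at I M1 v" "M1 r_adr = 4 + ?m * ?n" "M1 r_end = M r_end" "M1 r_found = 0"
      "M1 r_next = snd (row_gen I v)" "\<And>i. i < ?m \<Longrightarrow> M1 (20 + i) = fst (row_gen I v) i"
      using 16(2-) M by (auto simp: bits_at_def row_gen_def row_eq_def)
    show ?case
    proof (rule wp_gen_com[where w = "bit v" and X = X and T = "20 + ?m" and N = ?n and S = 1 and L = ?m and D = ?n],
        goal_cases)
      case (16 t2 M2)
      have M2: "bits_at I M2 v" "M2 r_lab = 4 + ?m * ?n" "M2 r_end = M r_end" "M2 r_found = 0"
        "tabs_at I M2 v"
        using 16(2-) M1 by (auto simp: bits_at_def col_gen_def col_eq_def tabs_at_def)
      show ?case unfolding wp_Seq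
      proof (rule wp_check_com[OF I M2(1,5,2), where X = X], goal_cases)
        case (4 t3 M3)
        have M3: "bits_at I M3 v" "tabs_at I M3 v" "M3 r_end = M r_end" "M3 r_found = 0"
          using 4(2) M2 frame_bits_tabs[of M3 M2 I v] by simp_all
        have time: "t1 + t2 + t3 \<le> 5000 * X ^ 3" using 4(1) 16(1) \<open>t1 \<le> 2000 * X ^ 3\<close> by simp
        show ?case
        proof (cases "guess_ok I v")
          case True
          then have "eval (input_word I) M3 (Sub (reg r_cost) in_k) = 0" using 4(3) by simp
          then show ?thesis using True time X1 M3
            by (auto simp: frame_bits_tabs[of "M3(2 := Suc 0)" M3] intro!: post)
        next
          case False
          then have "eval (input_word I) M3 (Sub (reg r_cost) in_k) \<noteq> 0" using 4(3) by simp
          then have "wp (input_word I) (If (Sub (reg r_cost) in_k) inc_com (r_found ::= Const 1)) Q' M3 out =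
              wp (input_word I) inc_com (\<lambda>t. Q' (1 + cost (Sub (reg r_cost) in_k) + t)) M3 out" for Q'
            by (simp only: wp_If if_True simp_thms)
          then show ?thesis
            by (simp only:) (rule wp_inc_com[OF M3(1) v], rule post, use time X1 M3 False in auto)
        qed
      qed (simp_all add: X)
    qed (use M1 in \<open>simp_all add: X bits_at_def\<close>)
  qed (use M in \<open>simp_all add: X bits_at_def\<close>)
qed

text \<open>
  The counter has passed all bit strings of length \<open>bit_count I\<close> as soon as the bit behind
  them, at the address in \<open>r_end\<close>, is set.
\<close>

definition gnrm_com :: com where
  "gnrm_com =
     init_com ;;
     While (Sub (Const 1) (Add (reg r_found) (Mem (reg r_end)))) try_com ;;
     If (reg r_found)
       (Write (Const 1) ;;
        write_mat r_row in_m r_role in_r (role_bit row_tab r_row r_role) ;;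
        write_mat r_role in_r r_col in_n (role_bit col_tab r_col r_role))
       (Write (Const 0))"

lemma wp_gnrm_com:
  assumes I: "I \<in> gnrm_instances"
    and X: "X = dim_row (upa I) + dim_col (upa I) + roles I + 1"
  shows "wp (input_word I) gnrm_com
    (\<lambda>t M ys. t \<le> 2 ^ bit_count I * (10000 * X ^ 3 + 100 * bit_count I) \<and> gnrm_output I ys) (\<lambda>_. 0) []"
proof -
  let ?m = "dim_row (upa I)" and ?n = "dim_col (upa I)" and ?N = "bit_count I"
  let ?B = "20 + (dim_row (upa I) + dim_col (upa I))"
  let ?b = "6000 * X ^ 3 + 100 * ?N"
  have X1: "1 \<le> X" "X \<le> X ^ 3" "X ^ 2 \<le> X ^ 3"
    unfolding X by (simp_all add: self_le_power power_increasing)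
  show ?thesis unfolding gnrm_com_def wp_Seq
  proof (rule wp_init_com, goal_cases)
    case (1 t1 M1)
    show ?case
    \<comment> \<open>Until a guess succeeds, the round index is the counter value itself;
      afterwards the guard is zero and the index is irrelevant.\<close>
    proof (rule wp_While[where n = "2 ^ ?N" and b = ?b and i = 0 and J = "\<lambda>v M out. out = [] \<and>
        M r_end = ?B + ?N \<and>
        (M r_found = 0 \<and> v \<le> 2 ^ ?N \<and> bits_at I M v \<and> (\<forall>u<v. \<not> guess_ok I u) \<or>
         M r_found = 1 \<and> (\<exists>u. guess_ok I u \<and> bits_at I M u \<and> tabs_at I M u))"], goal_cases)
      case 1
      then show ?case using \<open>bits_at I M1 0\<close> \<open>M1 r_end = _\<close> \<open>M1 r_found = 0\<close> by simp
    next
      case (2 v M out)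
      then have M: "out = []" "M r_end = ?B + ?N" "M r_found = 0" "bits_at I M v"
        "\<forall>u<v. \<not> guess_ok I u" "v \<le> 2 ^ ?N" by auto
      \<comment> \<open>The guard excludes \<open>v = 2 ^ ?N\<close>, whose bit \<open>?N\<close> is
        set; with \<open>v \<le> 2 ^ ?N\<close> this gives the strict bound.\<close>
      moreover have "M (?B + ?N) = 0" using 2(2) M(2,3) by simp
      then have "\<not> bit v ?N" using M(4) by (auto simp: bits_at_def)
      then have "v \<noteq> 2 ^ ?N" by (auto simp: bit_exp_iff)
      ultimately have v: "v < 2 ^ ?N" by simp
      show ?case
        by (rule conjI[OF v], rule wp_try_com[OF I M(4,3) v X])
          (use M v in \<open>auto simp: less_Suc_eq split: if_splits\<close>)
    next
      case (3 v M out t2)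
      \<comment> \<open>\<open>300 * X ^ 3\<close> is reserved for the final test and the output,
        whose writing takes at most \<open>210 * X ^ 2\<close>.\<close>
      have t: "t1 + t2 + 300 * X ^ 3 \<le> 2 ^ ?N * (10000 * X ^ 3 + 100 * ?N)"
      proof -
        let ?Y = "2 ^ ?N * X ^ 3"
        have "t1 \<le> 100 * X" using \<open>t1 \<le> _\<close> X by simp
        moreover have "t2 \<le> 6000 * ?Y + 2 ^ ?N * (100 * ?N) + 9 * 2 ^ ?N + 9"
          using 3(3) by (simp add: algebra_simps)
        moreover have "X ^ 3 \<le> ?Y" "2 ^ ?N \<le> ?Y" "1 \<le> ?Y" using X1 by simp_all
        ultimately have "t1 + t2 + 300 * X ^ 3 \<le> 10000 * ?Y + 2 ^ ?N * (100 * ?N)"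
          using X1(2) by linarith
        then show ?thesis by (simp add: algebra_simps)
      qed
      show ?case
      proof (cases "M r_found = 0")
        case True
        then have M: "out = []" "M r_end = ?B + ?N" "v \<le> 2 ^ ?N" "bits_at I M v"
          "\<forall>u<v. \<not> guess_ok I u" using 3(1) by auto
        have "M (?B + ?N) \<noteq> 0" using 3(2) M(2) True by simp
        then have "bit v ?N" using M(4) by (auto simp: bits_at_def split: if_splits)
        then have "\<not> v < 2 ^ ?N" using bit_less_power by blast
        then have "\<nexists>UA PA. gnrm_solution I UA PA"
          using M(5) solution_has_guess[OF I] by (metis not_le less_le_trans)
        then show ?thesis using True M(1) t X1 by (simp add: gnrm_output_def)
      next
        case False
        then obtain u where u: "out = []" "M r_found = 1" "guess_ok I u" "bits_at I M u" "tabs_at I M u"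
          using 3(1) by auto
        have "wp (input_word I) (Write (Const 1) ;;
            write_mat r_row in_m r_role in_r (role_bit row_tab r_row r_role) ;;
            write_mat r_role in_r r_col in_n (role_bit col_tab r_col r_role))
          (\<lambda>t M ys. t \<le> 210 * X ^ 2 \<and>
            ys = 1 # bool_words (guess_UA I u) @ bool_words (guess_PA I u)) M out"
          unfolding wp_Seq wp_Write
        proof (rule wp_write_mat[where X = X and a = ?m and b = "roles I" and
              g = "\<lambda>i l. of_bool (guess_UA I u $$ (i, l))"], goal_cases)
          case (10 t3 M3)
          show ?case
          proof (rule wp_write_mat[where X = X and a = "roles I" and b = ?n and
              g = "\<lambda>l j. of_bool (guess_PA I u $$ (l, j))"], goal_cases)
            case (10 t4 M4)
            then show ?case using \<open>t3 \<le> _\<close> u(1) one_le_power[OF X1(1), of 2]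
              by (simp add: mat_words_def guess_UA_def guess_PA_def)
          qed (use u 10(2) X in \<open>auto simp: guess_PA_def bits_at_def tabs_at_def add.assoc\<close>)
        qed (use u X in \<open>auto simp: guess_UA_def bits_at_def tabs_at_def add.assoc\<close>)
        then have "wp (input_word I) (Write (Const 1) ;;
            write_mat r_row in_m r_role in_r (role_bit row_tab r_row r_role) ;;
            write_mat r_role in_r r_col in_n (role_bit col_tab r_col r_role))
          (\<lambda>t M ys. t \<le> 210 * X ^ 2 \<and> gnrm_output I ys) M out"
          by (rule wp_mono) (use u(3) in \<open>auto simp: gnrm_output_def\<close>)
        then show ?thesis using False t X1
          by (simp only: wp_If eval.simps if_True simp_thms) (erule wp_mono, simp)
      qed
    qed
  qed
qed

text \<open>\<open>X\<close> contains r itself, which may be exponential in the input size. By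
  \<open>Suc r \<le> 2 ^ r\<close> its contribution to \<open>X ^ 3\<close> is at most
  \<open>2 ^ (3 * r)\<close>, hence at most a second factor \<open>2 ^ bit_count I\<close>; this
  explains the doubled exponent.\<close>

lemma gnrm_time_bound:
  assumes I: "I \<in> gnrm_instances"
    and X: "X = dim_row (upa I) + dim_col (upa I) + roles I + 1"
  shows "2 ^ bit_count I * (10000 * X ^ 3 + 100 * bit_count I) \<le>
    11000 * (2 ^ (2 * bit_count I) * gnrm_size I ^ 3)"
proof -
  let ?r = "roles I" and ?N = "bit_count I" and ?s = "gnrm_size I"
  \<comment> \<open>The binary length of r keeps the size positive even for empty matrices and
    provides the \<open>+ 1\<close> below.\<close>
  have "floorlog 2 ?r \<ge> 1" using I by (simp add: gnrm_instances_def floorlog_def)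
  then have s: "dim_row (upa I) + dim_col (upa I) + 1 \<le> ?s"
    by (simp add: gnrm_size_def Let_def)
  have "X \<le> ?s + ?r" using s X by simp
  also have "\<dots> \<le> ?s * Suc ?r" using s by simp
  also have "\<dots> \<le> ?s * 2 ^ ?r" using less_exp[of ?r] by (intro mult_left_mono Suc_leI) auto
  finally have "X ^ 3 \<le> (?s * 2 ^ ?r) ^ 3" by (rule power_mono) simp
  also have "\<dots> = ?s ^ 3 * 2 ^ (3 * ?r)" by (simp add: power_mult_distrib power_mult[symmetric] mult.commute)
  also have "\<dots> \<le> ?s ^ 3 * 2 ^ ?N"
  proof (intro mult_left_mono power_increasing)
    have "?r * 1 \<le> ?r * 2 ^ ?r" by (intro mult_left_mono) auto
    then show "3 * ?r \<le> ?N" unfolding bit_count_def by linarith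
  qed auto
  finally have 1: "X ^ 3 \<le> ?s ^ 3 * 2 ^ ?N" .
  have "?N * 1 \<le> 2 ^ ?N * ?s ^ 3" using less_exp[of ?N] s by (intro mult_mono) auto
  with 1 have "10000 * X ^ 3 + 100 * ?N \<le> 11000 * (2 ^ ?N * ?s ^ 3)" by (simp add: mult.commute)
  then have "2 ^ ?N * (10000 * X ^ 3 + 100 * ?N) \<le> 2 ^ ?N * (11000 * (2 ^ ?N * ?s ^ 3))"
    by (rule mult_left_mono) simp
  also have "\<dots> = 11000 * (2 ^ (2 * ?N) * ?s ^ 3)" by (simp add: mult_2 power_add)
  finally show ?thesis .
qed

theorem theorem2p7:
  "\<exists>(p :: com) (T :: gnrm \<Rightarrow> nat) (h :: gnrm \<Rightarrow> real).
     gnrm_solved_by p T \<and>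
     h \<in> gnrm_O (\<lambda>I. real (roles I) * 2 ^ roles I + real (roles I) * real (noise I)) \<and>
     (\<lambda>I. real (T I)) \<in> gnrm_O_star (\<lambda>I. 2 powr h I)"
proof -
  let ?bound = "\<lambda>I. 11000 * (2 ^ (2 * bit_count I) * gnrm_size I ^ 3)"
  have "\<exists>t. (\<exists>ys. computes gnrm_com (gnrm_input I) t ys \<and> gnrm_output I ys) \<and> t \<le> ?bound I"
    if I: "I \<in> gnrm_instances" for I
  proof -
    from wp_gnrm_com[OF I refl] obtain t M ys where
      "exec (input_word I) gnrm_com (\<lambda>_. 0, []) t (M, ys)" "gnrm_output I ys" "t \<le> ?bound I"
      unfolding wp_def using gnrm_time_bound[OF I refl] by (blast intro: le_trans)
    then show ?thesis unfolding computes_def input_word_def by blast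
  qed
  then obtain T where T: "\<And>I. I \<in> gnrm_instances \<Longrightarrow>
      (\<exists>ys. computes gnrm_com (gnrm_input I) (T I) ys \<and> gnrm_output I ys) \<and> T I \<le> ?bound I"
    by metis
  \<comment> \<open>\<open>2 * bit_count I\<close> is 8 times the prescribed exponent, hence the
    constant 8 below.\<close>
  let ?h = "\<lambda>I. real (2 * bit_count I)"
  have "gnrm_solved_by gnrm_com T" using T by (auto simp: gnrm_solved_by_def)
  moreover have "?h \<in> gnrm_O (\<lambda>I. real (roles I) * 2 ^ roles I + real (roles I) * real (noise I))"
    by (rule bigoI[where c = 8]) (simp add: eventually_principal bit_count_def)
  moreover have "(\<lambda>I. real (T I)) \<in> gnrm_O (\<lambda>I. 2 powr ?h I * real (gnrm_size I) ^ 3)"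
  proof (rule bigoI[where c = 11000], unfold eventually_principal, intro ballI)
    fix I assume "I \<in> gnrm_instances"
    then have "real (T I) \<le> real (?bound I)" using T by (intro of_nat_mono) blast
    also have "2 powr ?h I = 2 ^ (2 * bit_count I)" by (subst powr_realpow) simp_all
    then have "real (?bound I) = 11000 * (2 powr ?h I * real (gnrm_size I) ^ 3)" by simp
    finally show "norm (real (T I)) \<le> 11000 * norm (2 powr ?h I * real (gnrm_size I) ^ 3)"
      by simp
  qed
  then have "(\<lambda>I. real (T I)) \<in> gnrm_O_star (\<lambda>I. 2 powr ?h I)"
    unfolding gnrm_O_star_def by blast
  ultimately show ?thesis by blast
qed

end
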